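(* Let $L$ be a purely transcendental extension of a field $K$ of finite transcendence degree. Then: (i) Let $G$ be a subgroup of $Aut(L/K)$. Then $G$ is a Noether solution of $L/K$ if and only if each conjugate subgroup $\phi^{-1}G\phi$ ($\phi\in Aut(L/K)$) is a Noether solution of $L/K$. In such a case, the set $Con_{L/K}(G)$ of Noether $G$-solutions of $L/K$ equals $\{\phi^{-1}\cdot G\cdot\phi:\phi\in Aut(L/K)\}$. (ii) For each Noether solution $G$ of $L/K$, one has $con_{L/K}(G)\le ind_{L/K}(G)$. In particular, if $ind_{L/K}(G)=m<+\infty$, then there are at most $m$ Noether $G$-solutions of $L/K$. (iii) Let $G$ be a Noether solution of $L/K$. If $\Psi_{L/K}(G)$ has only one Zorn-component, then the class height group $CH_{L/K}(G)$ is isomorphic to a subgroup of the multiplicative group $(L^G)^{*}=L^G\setminus\{0\}$.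
   Context: For a field extension $L/K$, $Aut(L/K)$ is the group of field automorphisms of $L$ fixing $K$ pointwise. For a subset $H\subseteq Aut(L/K)$, $L^H=\{x\in L:\sigma(x)=x \text{ for all }\sigma\in H\}$. A Noether solution of a transcendental extension $L/K$ is a subgroup $G\subseteq Aut(L/K)$ such that $L$ is algebraic over $L^G$ and $L^G$ is purely transcendental over $K$. If $G$ is a Noether solution, a Noether $G$-solution of $L/K$ is a Noether solution $P$ of $L/K$ which is conjugate to $G$ in $Aut(L/K)$; $Con_{L/K}(G)$ is the set of Noether $G$-solutions and $con_{L/K}(G)=\sharp Con_{L/K}(G)$. $ind_{L/K}(G)$ denotes the index in $Aut(L/K)$ of the centralizer $Z_{Aut(L/K)}(G)$ of $G$. For a Noether solution $G$, $\Psi_{L/K}(G)$ is the set of all Noether solutions of $L/K$ containing $G$, partially ordered by inclusion; a Zorn-component of $\Psi_{L/K}(G)$ is a totally ordered subset $\Phi$ such that there is no $P_0\in\Psi_{L/K}(G)$ with $\Phi\cup\{P_0\}$ totally ordered and $P_0\notin\Phi$. The height group $H_{L/K}(G)$ is the subgroup of $Aut(L/K)$ generated by $\bigcup_{P\in\Psi_{L/K}(G)}P$. Let $\Pi=GL_K(L)$ be the group of $K$-linear automorphisms of $L$ (so $Aut(L/K)\subseteq\Pi$), $\Pi^{ab}=\Pi/[\Pi,\Pi]$, and $\tau_{L/K}:\Pi\to\Pi^{ab}$ the natural map. The class height group is $CH_{L/K}(G)=\tau_{L/K}(H_{L/K}(G))$. *)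

theory Defs
  imports "HOL-Algebra.Algebra"
begin

unbundle cardinal_syntax

section \<open>Transcendental extensions\<close>

text \<open>
  The library's indexed polynomials with coefficients in \<open>K\<close> and variables indexed by
  \<open>B \<subseteq> carrier L\<close> are functions from monomials (multisets over \<open>B\<close>) to coefficients;
  here the variable with index \<open>b\<close> is evaluated at the element \<open>b\<close> itself.
\<close>

definition indexed_poly_eval :: "('a, 'b) ring_scheme \<Rightarrow> ('a multiset \<Rightarrow> 'a) \<Rightarrow> 'a"
  where "indexed_poly_eval L P =
    (\<Oplus>\<^bsub>L\<^esub> m \<in> {m. P m \<noteq> \<zero>\<^bsub>L\<^esub>}. P m \<otimes>\<^bsub>L\<^esub> (\<Otimes>\<^bsub>L\<^esub> b \<in> set_mset m. b [^]\<^bsub>L\<^esub> count m b))"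

definition algebraically_independent :: "('a, 'b) ring_scheme \<Rightarrow> 'a set \<Rightarrow> 'a set \<Rightarrow> bool"
  where "algebraically_independent L K B \<longleftrightarrow>
    B \<subseteq> carrier L \<and>
    (\<forall>P \<in> ring.indexed_pset L B K.
       indexed_poly_eval L P = \<zero>\<^bsub>L\<^esub> \<longrightarrow> P = ring.indexed_const L \<zero>\<^bsub>L\<^esub>)"

definition algebraic_over :: "('a, 'b) ring_scheme \<Rightarrow> 'a set \<Rightarrow> bool"
  where "algebraic_over L F \<longleftrightarrow> (\<forall>x \<in> carrier L. ring.algebraic L F x)"

definition transcendence_basis :: "('a, 'b) ring_scheme \<Rightarrow> 'a set \<Rightarrow> 'a set \<Rightarrow> bool"
  where "transcendence_basis L K B \<longleftrightarrow>
    algebraically_independent L K B \<and> algebraic_over L (generate_field L (K \<union> B))"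

definition finite_transcendence_degree :: "('a, 'b) ring_scheme \<Rightarrow> 'a set \<Rightarrow> bool"
  where "finite_transcendence_degree L K \<longleftrightarrow> (\<exists>B. finite B \<and> transcendence_basis L K B)"

text \<open>\<open>F\<close> is an intermediate field of \<open>L / K\<close>, possibly all of \<open>L\<close>.\<close>

definition purely_transcendental :: "('a, 'b) ring_scheme \<Rightarrow> 'a set \<Rightarrow> 'a set \<Rightarrow> bool"
  where "purely_transcendental L K F \<longleftrightarrow>
    (\<exists>B. algebraically_independent L K B \<and> F = generate_field L (K \<union> B))"


section \<open>Automorphism groups\<close>

definition Aut_ext :: "('a, 'b) ring_scheme \<Rightarrow> 'a set \<Rightarrow> ('a \<Rightarrow> 'a) monoid"
  where "Aut_ext L K = (BijGroup (carrier L))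
    \<lparr>carrier := {f \<in> Bij (carrier L). f \<in> ring_hom L L \<and> (\<forall>k \<in> K. f k = k)}\<rparr>"

definition fixed_field :: "('a, 'b) ring_scheme \<Rightarrow> ('a \<Rightarrow> 'a) set \<Rightarrow> 'a set"
  where "fixed_field L H = {x \<in> carrier L. \<forall>f \<in> H. f x = x}"

definition GL_ext :: "('a, 'b) ring_scheme \<Rightarrow> 'a set \<Rightarrow> ('a \<Rightarrow> 'a) monoid"
  where "GL_ext L K = (BijGroup (carrier L))
    \<lparr>carrier := {f \<in> Bij (carrier L).
       (\<forall>x \<in> carrier L. \<forall>y \<in> carrier L. f (x \<oplus>\<^bsub>L\<^esub> y) = f x \<oplus>\<^bsub>L\<^esub> f y) \<and>
       (\<forall>k \<in> K. \<forall>x \<in> carrier L. f (k \<otimes>\<^bsub>L\<^esub> x) = k \<otimes>\<^bsub>L\<^esub> f x)}\<rparr>"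

definition centralizer :: "('a, 'b) monoid_scheme \<Rightarrow> 'a set \<Rightarrow> 'a set"
  where "centralizer A G = {x \<in> carrier A. \<forall>g \<in> G. x \<otimes>\<^bsub>A\<^esub> g = g \<otimes>\<^bsub>A\<^esub> x}"

definition conjugate_by :: "('a, 'b) monoid_scheme \<Rightarrow> 'a \<Rightarrow> 'a set \<Rightarrow> 'a set"
  where "conjugate_by A \<phi> G = inv\<^bsub>A\<^esub> \<phi> <#\<^bsub>A\<^esub> G #>\<^bsub>A\<^esub> \<phi>"

definition abelianization :: "('a, 'b) monoid_scheme \<Rightarrow> 'a set monoid"
  where "abelianization A = A Mod derived A (carrier A)"

definition abelianization_map :: "('a, 'b) monoid_scheme \<Rightarrow> 'a \<Rightarrow> 'a set"
  where "abelianization_map A x = derived A (carrier A) #>\<^bsub>A\<^esub> x"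


section \<open>Noether solutions\<close>

definition noether_solution :: "('a, 'b) ring_scheme \<Rightarrow> 'a set \<Rightarrow> ('a \<Rightarrow> 'a) set \<Rightarrow> bool"
  where "noether_solution L K G \<longleftrightarrow>
    subgroup G (Aut_ext L K) \<and>
    algebraic_over L (fixed_field L G) \<and>
    purely_transcendental L K (fixed_field L G)"

definition Con_ext :: "('a, 'b) ring_scheme \<Rightarrow> 'a set \<Rightarrow> ('a \<Rightarrow> 'a) set \<Rightarrow> ('a \<Rightarrow> 'a) set set"
  where "Con_ext L K G =
    {P. noether_solution L K P \<and> (\<exists>\<phi> \<in> carrier (Aut_ext L K). P = conjugate_by (Aut_ext L K) \<phi> G)}"

text \<open>The two numerical invariants may be infinite, hence are taken as cardinals.\<close>

definition con_ext :: "('a, 'b) ring_scheme \<Rightarrow> 'a set \<Rightarrow> ('a \<Rightarrow> 'a) set \<Rightarrow> ('a \<Rightarrow> 'a) set rel"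
  where "con_ext L K G = |Con_ext L K G|"

definition ind_ext :: "('a, 'b) ring_scheme \<Rightarrow> 'a set \<Rightarrow> ('a \<Rightarrow> 'a) set \<Rightarrow> ('a \<Rightarrow> 'a) set rel"
  where "ind_ext L K G = |rcosets\<^bsub>Aut_ext L K\<^esub> (centralizer (Aut_ext L K) G)|"

definition Psi_ext :: "('a, 'b) ring_scheme \<Rightarrow> 'a set \<Rightarrow> ('a \<Rightarrow> 'a) set \<Rightarrow> ('a \<Rightarrow> 'a) set set"
  where "Psi_ext L K G = {P. noether_solution L K P \<and> G \<subseteq> P}"

definition zorn_component :: "'a set set \<Rightarrow> 'a set set \<Rightarrow> bool"
  where "zorn_component \<Psi> \<Phi> \<longleftrightarrow>
    subset.chain \<Psi> \<Phi> \<and> \<not> (\<exists>P\<^sub>0 \<in> \<Psi>. subset.chain \<Psi> (\<Phi> \<union> {P\<^sub>0}) \<and> P\<^sub>0 \<notin> \<Phi>)"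

definition height_group :: "('a, 'b) ring_scheme \<Rightarrow> 'a set \<Rightarrow> ('a \<Rightarrow> 'a) set \<Rightarrow> ('a \<Rightarrow> 'a) set"
  where "height_group L K G = generate (Aut_ext L K) (\<Union> (Psi_ext L K G))"

definition class_height_group ::
    "('a, 'b) ring_scheme \<Rightarrow> 'a set \<Rightarrow> ('a \<Rightarrow> 'a) set \<Rightarrow> ('a \<Rightarrow> 'a) set monoid"
  where "class_height_group L K G = (abelianization (GL_ext L K))
    \<lparr>carrier := abelianization_map (GL_ext L K) ` height_group L K G\<rparr>"

end

theory Submission
  imports Defs
begin

text \<open>
  An automorphism \<open>\<phi>\<close> of \<open>L\<close> over \<open>K\<close> carries the fixed field of \<open>G\<close> to the fixed field of
  the corresponding conjugate of \<open>G\<close> and preserves algebraicity and pure transcendence, and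
  the conjugate \<open>\<phi>\<inverse> G \<phi>\<close> depends only on the coset of \<open>\<phi>\<close> modulo the centralizer of \<open>G\<close>;
  this gives the first two parts.

  For the third part, the class height group is in fact always trivial, because every element
  \<open>\<phi>\<close> of a Noether solution \<open>P\<close> is a product of two commutators in \<open>GL\<^sub>K(L)\<close>. If \<open>L = K\<close> then
  \<open>\<phi> = 1\<close>. Otherwise the fixed field \<open>F\<close> of \<open>P\<close> contains an element \<open>x\<close> transcendental over \<open>K\<close>.
  Write \<open>L = F \<oplus> C\<close> as vector spaces over \<open>K\<close>. Since \<open>\<phi>\<close> fixes \<open>F\<close> pointwise, it is the product
  of a transvection from \<open>C\<close> to \<open>F\<close>, which is a commutator with multiplication by \<open>x\<close> on \<open>F\<close>, and
  of a map that is the identity on \<open>F\<close> and preserves \<open>C\<close>. The latter is a commutator by an Eilenberg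
  swindle, provided that \<open>F\<close> has room for countably many copies of \<open>C\<close>. This holds because
  \<open>|L| \<le> max |K| \<aleph>\<^sub>0\<close> by finiteness of the transcendence degree, while \<open>dim\<^sub>K F \<ge> max |K| \<aleph>\<^sub>0\<close> by
  the independence of the powers of \<open>x\<close> and of the elements \<open>1 / (x - a)\<close> with \<open>a \<in> K\<close>.
\<close>

section \<open>Field extensions and polynomials over the base field\<close>

locale field_ext = field L for L (structure) +
  fixes K
  assumes subfield_base: "subfield K L"
begin

lemma base_subring: "subring K L"
  using subfieldE(1)[OF subfield_base] .

lemma base_carrier: "K \<subseteq> carrier L"
  using subringE(1)[OF base_subring] .

lemma base_in_carrier [simp, intro]: "k \<in> K \<Longrightarrow> k \<in> carrier L"
  using base_carrier by blast

lemmas base_closed [simp, intro] = subringE(2,3,5,6,7)[OF base_subring]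

lemma base_minus_closed [simp, intro]: "a \<in> K \<Longrightarrow> b \<in> K \<Longrightarrow> a \<ominus> b \<in> K"
  by (simp add: a_minus_def)

lemma base_inv_closed: "k \<in> K \<Longrightarrow> k \<noteq> \<zero> \<Longrightarrow> inv k \<in> K"
  using subfield_m_inv(1)[OF subfield_base] by blast

section \<open>Algebraic independence\<close>

text \<open>Replaces the inductive description by conditions that can be checked for a given
  function. Conversely, a finitely supported function is a sum of monomials, and each monomial
  arises from a constant by multiplying with its variables one at a time.\<close>

lemma indexed_pset_iff:
  "P \<in> indexed_pset I K \<longleftrightarrow>
     finite {m. P m \<noteq> \<zero>} \<and> range P \<subseteq> K \<and> (\<forall>m. P m \<noteq> \<zero> \<longrightarrow> set_mset m \<subseteq> I)"
proof
  assume "P \<in> indexed_pset I K"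
  then show "finite {m. P m \<noteq> \<zero>} \<and> range P \<subseteq> K \<and> (\<forall>m. P m \<noteq> \<zero> \<longrightarrow> set_mset m \<subseteq> I)"
  proof (induction rule: indexed_pset.induct)
    case (indexed_const k)
    have "{m. indexed_const k m \<noteq> \<zero>} \<subseteq> {{#}}"
      by (auto simp: indexed_const_def split: if_splits)
    then show ?case
      using indexed_const finite_subset by (fastforce simp: indexed_const_def split: if_splits)
  next
    case (indexed_padd P Q)
    have "{m. indexed_padd P Q m \<noteq> \<zero>} \<subseteq> {m. P m \<noteq> \<zero>} \<union> {m. Q m \<noteq> \<zero>}"
      by (auto simp: indexed_padd_def)
    then have "finite {m. indexed_padd P Q m \<noteq> \<zero>}"
      using indexed_padd finite_subset by blast
    moreover have "range (indexed_padd P Q) \<subseteq> K"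
      using indexed_padd by (auto simp: indexed_padd_def image_subset_iff)
    moreover have "set_mset m \<subseteq> I" if "indexed_padd P Q m \<noteq> \<zero>" for m
    proof -
      have "P m \<noteq> \<zero> \<or> Q m \<noteq> \<zero>" using that by (auto simp: indexed_padd_def)
      then show ?thesis using indexed_padd by blast
    qed
    ultimately show ?case by blast
  next
    case (indexed_pmult P i)
    have "{m. indexed_pmult P i m \<noteq> \<zero>} \<subseteq> add_mset i ` {m. P m \<noteq> \<zero>}"
      by (auto simp: indexed_pmult_def image_iff split: if_splits) (metis insert_DiffM)
    then have "finite {m. indexed_pmult P i m \<noteq> \<zero>}"
      using indexed_pmult finite_subset by blast
    moreover have "set_mset m \<subseteq> I" if "indexed_pmult P i m \<noteq> \<zero>" for m
    proof -
      have "i \<in># m" "P (m - {#i#}) \<noteq> \<zero>"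
        using that by (auto simp: indexed_pmult_def split: if_splits)
      then have "set_mset (m - {#i#}) \<subseteq> I" using indexed_pmult by blast
      then show ?thesis using \<open>i \<in># m\<close> indexed_pmult.hyps
        by (metis insert_DiffM insert_subset set_mset_add_mset_insert)
    qed
    ultimately show ?case using indexed_pmult
      by (auto simp: indexed_pmult_def image_subset_iff)
  qed
next
  have monomial: "(\<lambda>n. if n = m then k else \<zero>) \<in> indexed_pset I K"
    if "k \<in> K" "set_mset m \<subseteq> I" for k m
    using that(2)
  proof (induction m)
    case empty
    then show ?case
      using indexed_pset.indexed_const[OF that(1)] by (simp add: indexed_const_def)
  next
    case (add i m)
    have "(\<lambda>n. if n = add_mset i m then k else \<zero>) = indexed_pmult (\<lambda>n. if n = m then k else \<zero>) i"
      unfolding indexed_pmult_def by (rule ext) (metis diff_union_single_conv insert_DiffM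
        add_mset_remove_trivial union_single_eq_member)
    then show ?case using add indexed_pset.indexed_pmult by auto
  qed
  \<comment> \<open>The induction runs over a finite set \<open>S\<close> that merely contains the
    support, so that setting one value to zero stays within the induction hypothesis.\<close>
  have "finite S \<Longrightarrow> {m. P m \<noteq> \<zero>} \<subseteq> S \<Longrightarrow> range P \<subseteq> K \<Longrightarrow>
      (\<forall>m. P m \<noteq> \<zero> \<longrightarrow> set_mset m \<subseteq> I) \<Longrightarrow> P \<in> indexed_pset I K" for S
  proof (induction S arbitrary: P rule: finite_induct)
    case empty
    then have "P = indexed_const \<zero>" by (auto simp: indexed_const_def)
    then show ?case using indexed_pset.indexed_const base_closed(1) by auto
  next
    case (insert n S)
    show ?case
    proof (cases "P n = \<zero>")
      case True
      then show ?thesis using insert.IH[of P] insert.prems by auto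
    next
      case False
      have 1: "P(n := \<zero>) \<in> indexed_pset I K"
        using insert.prems by (intro insert.IH) auto
      have 2: "(\<lambda>m. if m = n then P n else \<zero>) \<in> indexed_pset I K"
        using insert.prems False by (intro monomial) auto
      have "P = indexed_padd (P(n := \<zero>)) (\<lambda>m. if m = n then P n else \<zero>)"
        using insert.prems by (auto simp: indexed_padd_def fun_eq_iff image_subset_iff)
      then show ?thesis using indexed_pset.indexed_padd[OF 1 2] by simp
    qed
  qed
  then show "finite {m. P m \<noteq> \<zero>} \<and> range P \<subseteq> K \<and> (\<forall>m. P m \<noteq> \<zero> \<longrightarrow> set_mset m \<subseteq> I) \<Longrightarrow>
      P \<in> indexed_pset I K" by blast
qed

lemma eval_eq_finsum:
  assumes "set p \<subseteq> carrier L" "x \<in> carrier L"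
  shows "eval p x = (\<Oplus>i \<in> {..<length p}. coeff p i \<otimes> x [^] i)"
  using assms(1)
proof (induction p)
  case (Cons c p)
  have "(\<Oplus>i \<in> {..<length p}. coeff (c # p) i \<otimes> x [^] i) = (\<Oplus>i \<in> {..<length p}. coeff p i \<otimes> x [^] i)"
    using Cons.prems assms(2) by (intro add.finprod_cong') auto
  moreover have "coeff (c # p) i \<in> carrier L" for i
    using coeff_in_carrier[OF Cons.prems] .
  ultimately show ?case
    using Cons assms(2) by (simp add: lessThan_Suc add.finprod_insert)
qed simp

text \<open>A univariate polynomial vanishing at \<open>b\<close> is also an indexed polynomial, one
  whose monomials are powers of the single variable \<open>b\<close>. Independence forces it to be
  zero.\<close>

lemma algebraically_independent_transcendental:
  assumes "algebraically_independent L K B" "b \<in> B"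
  shows "transcendental K b"
proof -
  have B: "B \<subseteq> carrier L" and indep: "\<And>P. P \<in> indexed_pset B K \<Longrightarrow>
      indexed_poly_eval L P = \<zero> \<Longrightarrow> P = indexed_const \<zero>"
    using assms(1) by (auto simp: algebraically_independent_def)
  have b: "b \<in> carrier L" using B assms(2) by blast
  have "p = []" if p: "p \<in> carrier (K[X])" "eval p b = \<zero>" for p
  proof -
    have setp: "set p \<subseteq> K" and lead: "p \<noteq> [] \<Longrightarrow> hd p \<noteq> \<zero>"
      using p(1) by (auto simp: univ_poly_def polynomial_def)
    then have setp': "set p \<subseteq> carrier L" by auto
    have coeffK: "coeff p i \<in> K" for i
      using setp by (induction p) auto
    have long: "coeff p i = \<zero>" if "i \<ge> length p" for i
      using that coeff_length by blast
    \<comment> \<open>The multiset with \<open>i\<close> copies of \<open>b\<close> is the monomial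
      whose value is the \<open>i\<close>-th power of \<open>b\<close>.\<close>
    let ?mon = "\<lambda>i. replicate_mset i b"
    define P where "P m = (if m = ?mon (size m) then coeff p (size m) else \<zero>)" for m
    have supp: "{m. P m \<noteq> \<zero>} \<subseteq> ?mon ` {..<length p}"
    proof
      fix m assume "m \<in> {m. P m \<noteq> \<zero>}"
      then have "m = ?mon (size m)" "coeff p (size m) \<noteq> \<zero>"
        by (auto simp: P_def split: if_splits)
      then show "m \<in> ?mon ` {..<length p}"
        using long by (metis imageI lessThan_iff not_le)
    qed
    have Pmon: "P (?mon i) = coeff p i" for i by (simp add: P_def)
    have "P \<in> indexed_pset B K"
      unfolding indexed_pset_iff
    proof (intro conjI allI impI)
      show "finite {m. P m \<noteq> \<zero>}" using supp finite_subset by blast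
      show "range P \<subseteq> K" using coeffK by (auto simp: P_def)
      show "set_mset m \<subseteq> B" if "P m \<noteq> \<zero>" for m
        using that supp assms(2) by (auto split: if_splits)
    qed
    moreover have "indexed_poly_eval L P = eval p b"
    proof -
      let ?t = "\<lambda>m. P m \<otimes> (\<Otimes>b \<in> set_mset m. b [^] count m b)"
      have t: "?t (?mon i) = coeff p i \<otimes> b [^] i" for i
        using b coeffK Pmon[of i] by (cases "i = 0") auto
      have tc: "?t (?mon i) \<in> carrier L" for i
        unfolding t using b coeffK by blast
      have "indexed_poly_eval L P = (\<Oplus>m \<in> ?mon ` {..<length p}. ?t m)"
        unfolding indexed_poly_eval_def
      proof (rule add.finprod_mono_neutral_cong_left)
        show "?t m = \<zero>" if "m \<in> ?mon ` {..<length p} - {m. P m \<noteq> \<zero>}" for m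
          using that b by (auto simp: t Pmon simp del: count_replicate_mset)
        show "?t \<in> ?mon ` {..<length p} \<rightarrow> carrier L"
          using tc by blast
      qed (use supp in auto)
      also have "\<dots> = (\<Oplus>i \<in> {..<length p}. ?t (?mon i))"
      proof (rule add.finprod_reindex)
        show "?t \<in> ?mon ` {..<length p} \<rightarrow> carrier L"
          using tc by blast
        show "inj_on ?mon {..<length p}"
          by (rule inj_onI) (metis size_replicate_mset)
      qed
      also have "\<dots> = eval p b"
        unfolding eval_eq_finsum[OF setp' b]
        using tc by (intro add.finprod_cong') (auto simp only: t Pi_iff)
      finally show ?thesis .
    qed
    ultimately have "P = indexed_const \<zero>" using indep p(2) by simp
    then have "coeff p i = \<zero>" for i
      using Pmon[of i] by (simp add: indexed_const_def)
    \<comment> \<open>A nonempty list in \<open>K[X]\<close> has a nonzero head, which is its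
      leading coefficient.\<close>
    then show "p = []"
      using lead by (metis coeff.simps(2) list.collapse)
  qed
  then have "a_kernel (K[X]) L (\<lambda>p. eval p b) = {[]}"
    unfolding a_kernel_def' by (auto simp: univ_poly_def polynomial_def)
  then show ?thesis
    using trivial_ker_imp_transcendental[OF base_subring b] by (simp add: over_def)
qed

section \<open>Linear algebra over the base field\<close>

text \<open>A linear combination is built by adding one scaled vector at a time, so that statements
  about spans follow by induction without manipulating sums.\<close>

inductive_set spn :: "'a set \<Rightarrow> 'a set" for S where
  zero: "\<zero> \<in> spn S"
| step: "v \<in> spn S \<Longrightarrow> c \<in> K \<Longrightarrow> s \<in> S \<Longrightarrow> c \<otimes> s \<oplus> v \<in> spn S"

definition subspace :: "'a set \<Rightarrow> bool"
  where "subspace W \<longleftrightarrow> W \<subseteq> carrier L \<and> \<zero> \<in> W \<and> (\<forall>v\<in>W. \<forall>w\<in>W. v \<oplus> w \<in> W) \<and>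
    (\<forall>c\<in>K. \<forall>v\<in>W. c \<otimes> v \<in> W)"

definition K_linear :: "('a \<Rightarrow> 'a) \<Rightarrow> bool"
  where "K_linear T \<longleftrightarrow> T \<in> carrier L \<rightarrow> carrier L \<and>
    (\<forall>v\<in>carrier L. \<forall>w\<in>carrier L. T (v \<oplus> w) = T v \<oplus> T w) \<and>
    (\<forall>c\<in>K. \<forall>v\<in>carrier L. T (c \<otimes> v) = c \<otimes> T v)"

text \<open>This form speaks about sets and spans only, which suits both Zorn's lemma and the
  exchange argument.\<close>

definition lin_indep :: "'a set \<Rightarrow> bool"
  where "lin_indep S \<longleftrightarrow> S \<subseteq> carrier L \<and> (\<forall>s\<in>S. s \<notin> spn (S - {s}))"

lemma spn_min: "subspace W \<Longrightarrow> S \<subseteq> W \<Longrightarrow> spn S \<subseteq> W"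
proof
  fix v assume W: "subspace W" "S \<subseteq> W" and "v \<in> spn S"
  from this(3) show "v \<in> W"
    by induction (use W in \<open>auto simp: subspace_def\<close>)
qed

lemma subspace_carrier: "subspace (carrier L)"
  by (auto simp: subspace_def)

lemma subspace_minus: "subspace W \<Longrightarrow> v \<in> W \<Longrightarrow> w \<in> W \<Longrightarrow> v \<ominus> w \<in> W"
proof -
  assume W: "subspace W" "v \<in> W" "w \<in> W"
  then have c: "v \<in> carrier L" "w \<in> carrier L" by (auto simp: subspace_def)
  have "\<ominus> \<one> \<in> K" by simp
  then have "v \<oplus> (\<ominus> \<one>) \<otimes> w \<in> W" using W by (auto simp: subspace_def)
  moreover have "v \<oplus> (\<ominus> \<one>) \<otimes> w = v \<ominus> w" using c by algebra
  ultimately show ?thesis by simp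
qed

context
  fixes S assumes S: "S \<subseteq> carrier L"
begin

lemma spn_carrier: "spn S \<subseteq> carrier L"
  using spn_min[OF subspace_carrier S] .

lemma spn_add: "v \<in> spn S \<Longrightarrow> w \<in> spn S \<Longrightarrow> v \<oplus> w \<in> spn S"
proof (induction rule: spn.induct)
  case (step v c s)
  have "v \<in> carrier L" "w \<in> carrier L" "s \<in> carrier L"
    using step spn_carrier S by auto
  then have "c \<otimes> s \<oplus> v \<oplus> w = c \<otimes> s \<oplus> (v \<oplus> w)"
    using step(2) by (simp add: a_assoc)
  then show ?case using step by (simp add: spn.step)
qed (use spn_carrier in auto)

lemma spn_scale: "v \<in> spn S \<Longrightarrow> k \<in> K \<Longrightarrow> k \<otimes> v \<in> spn S"
proof (induction rule: spn.induct)
  case (step v c s)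
  have "v \<in> carrier L" "s \<in> carrier L" "c \<in> carrier L" "k \<in> carrier L"
    using step spn_carrier S by auto
  then have "k \<otimes> (c \<otimes> s \<oplus> v) = (k \<otimes> c) \<otimes> s \<oplus> k \<otimes> v"
    by (simp add: r_distr m_assoc)
  then show ?case using step by (simp add: spn.step)
qed (auto intro: spn.zero)

lemma subspace_spn: "subspace (spn S)"
  using spn_carrier spn_add spn_scale spn.zero by (auto simp: subspace_def)

lemma spn_base: "s \<in> S \<Longrightarrow> s \<in> spn S"
  using spn.step[OF spn.zero, of \<one> s S] S by auto

end

lemma spn_mono: "S \<subseteq> T \<Longrightarrow> spn S \<subseteq> spn T"
proof
  fix v assume "S \<subseteq> T" "v \<in> spn S"
  from this(2) show "v \<in> spn T"
    by induction (use \<open>S \<subseteq> T\<close> in \<open>auto intro: spn.intros\<close>)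
qed

text \<open>Exchange argument: if an old vector \<open>s\<close> depended on \<open>v\<close> and
  the other vectors of \<open>S\<close>, the coefficient of \<open>v\<close> would be nonzero
  because \<open>S\<close> is independent. Solving for \<open>v\<close> would then put it into
  \<open>spn S\<close>.\<close>

lemma lin_indep_insert:
  assumes S: "lin_indep S" and v: "v \<in> carrier L" "v \<notin> spn S"
  shows "lin_indep (insert v S)"
  unfolding lin_indep_def
proof (intro conjI ballI)
  have Sc: "S \<subseteq> carrier L" using S by (simp add: lin_indep_def)
  then show "insert v S \<subseteq> carrier L" using v by blast
  fix s assume s: "s \<in> insert v S"
  have vS: "v \<notin> S" using spn_base[OF Sc] v by blast
  show "s \<notin> spn (insert v S - {s})"
  proof (cases "s = v")
    case True
    then show ?thesis using vS v by simp
  next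
    case False
    then have sS: "s \<in> S" using s by blast
    define T where "T = S - {s}"
    have T: "T \<subseteq> carrier L" using Sc T_def by blast
    have decomp: "\<exists>w\<in>spn T. \<exists>c\<in>K. u = w \<oplus> c \<otimes> v" if "u \<in> spn (insert v T)" for u
      using that
    proof induction
      case zero
      have "\<zero> = \<zero> \<oplus> \<zero> \<otimes> v" using v by simp
      then show ?case using spn.zero base_closed(1) by blast
    next
      case (step u c t)
      then obtain w k where w: "w \<in> spn T" "k \<in> K" "u = w \<oplus> k \<otimes> v" by blast
      have wc: "w \<in> carrier L" "k \<in> carrier L" "c \<in> carrier L" "t \<in> carrier L"
        using w step spn_carrier[OF T] T v by auto
      show ?case
      proof (cases "t = v")
        case True
        have "c \<otimes> t \<oplus> u = w \<oplus> (c \<oplus> k) \<otimes> v" using w wc v True by algebra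
        then show ?thesis using w step by blast
      next
        case False
        have "c \<otimes> t \<oplus> u = (c \<otimes> t \<oplus> w) \<oplus> k \<otimes> v" using w wc v by algebra
        moreover have "c \<otimes> t \<oplus> w \<in> spn T" using False step w by (auto intro: spn.step)
        ultimately show ?thesis using w by blast
      qed
    qed
    show ?thesis
    proof
      assume "s \<in> spn (insert v S - {s})"
      then have "s \<in> spn (insert v T)" using False by (simp add: T_def insert_Diff_if)
      then obtain w c where w: "w \<in> spn T" "c \<in> K" "s = w \<oplus> c \<otimes> v" using decomp by blast
      have wc: "w \<in> carrier L" "c \<in> carrier L" "s \<in> carrier L"
        using w spn_carrier[OF T] sS Sc by auto
      have "c \<noteq> \<zero>"
      proof
        assume "c = \<zero>"
        then have "s \<in> spn T" using w v wc by simp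
        then show False using S sS by (auto simp: lin_indep_def T_def)
      qed
      then have c: "inv c \<in> K" "inv c \<in> carrier L" "inv c \<otimes> c = \<one>"
        using base_inv_closed w wc field_Units by auto
      have "c \<otimes> v = s \<ominus> w" using w(3) wc v by algebra
      moreover have "v = inv c \<otimes> (c \<otimes> v)" using c wc v by (simp add: m_assoc[symmetric])
      ultimately have "v = inv c \<otimes> (s \<ominus> w)" by simp
      moreover have "s \<ominus> w \<in> spn S"
        using subspace_minus[OF subspace_spn[OF Sc]] spn_base[OF Sc sS] w(1)
          spn_mono[of T S] by (auto simp: T_def)
      ultimately have "v \<in> spn S" using spn_scale[OF Sc] c by simp
      then show False using v by blast
    qed
  qed
qed

text \<open>Zorn's lemma applied to the independent sets between \<open>S\<close> and
  \<open>W\<close>; a maximal one spans \<open>W\<close> by \<open>lin_indep_insert\<close>.\<close>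

lemma lin_indep_extends_to_basis:
  assumes W: "subspace W" and S: "lin_indep S" "S \<subseteq> W"
  obtains Y where "S \<subseteq> Y" "lin_indep Y" "spn Y = W"
proof -
  let ?A = "{T. S \<subseteq> T \<and> T \<subseteq> W \<and> lin_indep T}"
  have Wc: "W \<subseteq> carrier L" using W by (simp add: subspace_def)
  have "\<exists>M\<in>?A. \<forall>E\<in>?A. M \<subseteq> E \<longrightarrow> E = M"
  proof (rule subset_Zorn_nonempty)
    show "?A \<noteq> {}" using S by blast
    fix \<C> assume ne: "\<C> \<noteq> {}" and ch: "subset.chain ?A \<C>"
    have mem: "S \<subseteq> T \<and> T \<subseteq> W \<and> lin_indep T" if "T \<in> \<C>" for T
      using ch that by (auto simp: subset.chain_def)
    have cmp: "T \<subseteq> U \<or> U \<subseteq> T" if "T \<in> \<C>" "U \<in> \<C>" for T U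
      using ch that unfolding subset.chain_def by blast
    \<comment> \<open>A vector in a span involves only finitely many generators, and these lie in a
      single member of the chain. Hence the union of the chain stays independent.\<close>
    have fin: "\<exists>T\<in>\<C>. v \<in> spn (T - {s})" if "v \<in> spn (\<Union>\<C> - {s})" for v s
      using that
    proof induction
      case zero
      then show ?case using ne spn.zero by blast
    next
      case (step v c t)
      then obtain T U where T: "T \<in> \<C>" "v \<in> spn (T - {s})" and U: "U \<in> \<C>" "t \<in> U - {s}"
        by blast
      from cmp[OF T(1) U(1)] show ?case
      proof
        assume "T \<subseteq> U"
        then have "v \<in> spn (U - {s})" using T spn_mono[of "T - {s}" "U - {s}"] by blast
        then show ?thesis using U step spn.step by blast
      next
        assume "U \<subseteq> T"
        then show ?thesis using U T step spn.step by blast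
      qed
    qed
    have "lin_indep (\<Union>\<C>)"
      unfolding lin_indep_def
    proof (intro conjI ballI notI)
      show "\<Union>\<C> \<subseteq> carrier L" using mem Wc by blast
      fix s assume s: "s \<in> \<Union>\<C>" "s \<in> spn (\<Union>\<C> - {s})"
      then obtain T U where T: "T \<in> \<C>" "s \<in> spn (T - {s})" and U: "U \<in> \<C>" "s \<in> U"
        using fin by blast
      obtain V where V: "V \<in> \<C>" "T \<subseteq> V" "U \<subseteq> V" using cmp T U by blast
      then have "s \<in> spn (V - {s})" using T spn_mono[of "T - {s}" "V - {s}"] by blast
      then show False using V U mem[OF V(1)] by (auto simp: lin_indep_def)
    qed
    then show "\<Union>\<C> \<in> ?A" using mem ne by blast
  qed
  then obtain M where "M \<in> ?A" and max: "\<forall>E\<in>?A. M \<subseteq> E \<longrightarrow> E = M"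
    by (rule bexE)
  then have M: "S \<subseteq> M" "M \<subseteq> W" "lin_indep M" by simp_all
  have "W \<subseteq> spn M"
  proof
    fix v assume v: "v \<in> W"
    show "v \<in> spn M"
    proof (rule ccontr)
      assume "v \<notin> spn M"
      then have "lin_indep (insert v M)" using lin_indep_insert M v Wc by blast
      then have "insert v M \<in> ?A" using M v by blast
      then have "insert v M = M" using max by (metis subset_insertI)
      then show False using \<open>v \<notin> spn M\<close> spn_base[of M v] M Wc by blast
    qed
  qed
  then have "spn M = W" using spn_min[OF W M(2)] by blast
  with M show thesis using that by blast
qed

lemma K_linearD:
  assumes "K_linear T"
  shows "v \<in> carrier L \<Longrightarrow> T v \<in> carrier L"
    and "v \<in> carrier L \<Longrightarrow> w \<in> carrier L \<Longrightarrow> T (v \<oplus> w) = T v \<oplus> T w"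
    and "c \<in> K \<Longrightarrow> v \<in> carrier L \<Longrightarrow> T (c \<otimes> v) = c \<otimes> T v"
  using assms by (auto simp: K_linear_def)

lemma K_linear_zero: "K_linear T \<Longrightarrow> T \<zero> = \<zero>"
  using K_linearD(1,3)[of T] by (metis base_closed(1) l_null zero_closed)

lemma K_linear_minus:
  assumes "K_linear T" "v \<in> carrier L" "w \<in> carrier L"
  shows "T (v \<ominus> w) = T v \<ominus> T w"
proof -
  have m: "\<ominus> \<one> \<in> K" by simp
  have "v \<ominus> w = v \<oplus> (\<ominus> \<one>) \<otimes> w" using assms by algebra
  then have "T (v \<ominus> w) = T v \<oplus> (\<ominus> \<one>) \<otimes> T w"
    using K_linearD[OF assms(1)] assms m by simp
  then show ?thesis using K_linearD(1)[OF assms(1)] assms by (simp, algebra)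
qed

lemma K_linear_cong: "K_linear T \<Longrightarrow> (\<And>v. v \<in> carrier L \<Longrightarrow> T v = U v) \<Longrightarrow> K_linear U"
  by (auto simp: K_linear_def Pi_iff)

lemma K_linear_comp: "K_linear T \<Longrightarrow> K_linear U \<Longrightarrow> K_linear (\<lambda>v. T (U v))"
  by (auto simp: K_linear_def Pi_iff)

lemma K_linear_add: "K_linear T \<Longrightarrow> K_linear U \<Longrightarrow> K_linear (\<lambda>v. T v \<oplus> U v)"
  by (auto simp: K_linear_def Pi_iff r_distr add.m_ac)

lemma K_linear_mult: "y \<in> carrier L \<Longrightarrow> K_linear T \<Longrightarrow> K_linear (\<lambda>v. y \<otimes> T v)"
  by (auto simp: K_linear_def Pi_iff r_distr m_lcomm)

lemma K_linear_diff:
  assumes "K_linear T" "K_linear U" shows "K_linear (\<lambda>v. T v \<ominus> U v)"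
proof -
  have T: "T v \<in> carrier L" "U v \<in> carrier L" if "v \<in> carrier L" for v
    using that assms by (auto simp: K_linear_def)
  have "K_linear (\<lambda>v. T v \<oplus> (\<ominus> \<one>) \<otimes> U v)"
    by (intro K_linear_add K_linear_mult assms) simp
  moreover have "T v \<oplus> (\<ominus> \<one>) \<otimes> U v = T v \<ominus> U v" if "v \<in> carrier L" for v
    using T[OF that] by algebra
  ultimately show ?thesis by (rule K_linear_cong)
qed

lemma K_linear_id: "K_linear (\<lambda>v. v)"
  by (auto simp: K_linear_def)

lemma K_linear_eq_on_spn:
  assumes "K_linear T" "K_linear U" "S \<subseteq> carrier L" "\<And>s. s \<in> S \<Longrightarrow> T s = U s" "v \<in> spn S"
  shows "T v = U v"
  using assms(5)
proof induction
  case zero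
  then show ?case using K_linear_zero[OF assms(1)] K_linear_zero[OF assms(2)] by simp
next
  case (step v c s)
  have "v \<in> carrier L" "s \<in> carrier L" "c \<otimes> s \<in> carrier L"
    using step spn_carrier[OF assms(3)] assms(3) by auto
  then show ?case
    using K_linearD[OF assms(1)] K_linearD[OF assms(2)] step assms(4) by simp
qed

lemma K_linear_image_spn:
  assumes "K_linear T" "S \<subseteq> carrier L" "subspace W" "\<And>s. s \<in> S \<Longrightarrow> T s \<in> W" "v \<in> spn S"
  shows "T v \<in> W"
  using assms(5)
proof induction
  case zero
  then show ?case using K_linear_zero[OF assms(1)] assms(3) by (simp add: subspace_def)
next
  case (step v c s)
  have "v \<in> carrier L" "s \<in> carrier L" "c \<otimes> s \<in> carrier L"
    using step spn_carrier[OF assms(2)] assms(2) by auto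
  then show ?case
    using K_linearD[OF assms(1)] step assms(3,4) by (simp add: subspace_def)
qed

text \<open>Each coordinate is determined separately by its remainder in the span of the other basis
  vectors, so no expansion of \<open>v\<close> has to be chosen.\<close>

definition coord :: "'a set \<Rightarrow> 'a \<Rightarrow> 'a \<Rightarrow> 'a"
  where "coord E x v = (THE c. c \<in> K \<and> v \<ominus> c \<otimes> x \<in> spn (E - {x}))"

text \<open>The basis may be infinite, so the sum runs over the nonzero coordinates only; for a
  basis these are finite in number by \<open>finite_coord\<close>.\<close>

definition lin_extend :: "'a set \<Rightarrow> ('a \<Rightarrow> 'a) \<Rightarrow> 'a \<Rightarrow> 'a"
  where "lin_extend E f v = (\<Oplus>x \<in> {x \<in> E. coord E x v \<noteq> \<zero>}. coord E x v \<otimes> f x)"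

end

section \<open>Coordinates with respect to a basis and linear extension\<close>

locale field_ext_basis = field_ext +
  fixes E
  assumes basis_indep: "lin_indep E" and basis_span: "spn E = carrier L"
begin

lemma basis_carrier: "E \<subseteq> carrier L"
  using basis_indep by (simp add: lin_indep_def)

text \<open>If \<open>c\<close> and \<open>d\<close> both qualify, subtracting the remainders puts
  \<open>(d \<ominus> c) \<otimes> x\<close> into the span of the other basis vectors. Dividing by
  \<open>d \<ominus> c\<close> would contradict independence.\<close>

lemma coord_eqI:
  assumes x: "x \<in> E" and v: "v \<in> carrier L" and c: "c \<in> K" "v \<ominus> c \<otimes> x \<in> spn (E - {x})"
  shows "coord E x v = c"
  unfolding coord_def
proof (rule the_equality)
  show "c \<in> K \<and> v \<ominus> c \<otimes> x \<in> spn (E - {x})" using c by blast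
  fix d assume d: "d \<in> K \<and> v \<ominus> d \<otimes> x \<in> spn (E - {x})"
  have Ex: "E - {x} \<subseteq> carrier L" using basis_carrier by blast
  have cc: "x \<in> carrier L" "c \<in> carrier L" "d \<in> carrier L" using x basis_carrier c d by auto
  show "d = c"
  proof (rule ccontr)
    assume "d \<noteq> c"
    then have nz: "d \<ominus> c \<noteq> \<zero>" using cc by (simp add: r_right_minus_eq)
    have i: "inv (d \<ominus> c) \<in> K" "inv (d \<ominus> c) \<in> carrier L" "inv (d \<ominus> c) \<otimes> (d \<ominus> c) = \<one>"
      using base_inv_closed[OF _ nz] c d cc nz field_Units by auto
    have "(v \<ominus> c \<otimes> x) \<ominus> (v \<ominus> d \<otimes> x) \<in> spn (E - {x})"
      using subspace_minus[OF subspace_spn[OF Ex]] c d by blast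
    moreover have "(v \<ominus> c \<otimes> x) \<ominus> (v \<ominus> d \<otimes> x) = (d \<ominus> c) \<otimes> x"
      using cc v by algebra
    ultimately have "inv (d \<ominus> c) \<otimes> ((d \<ominus> c) \<otimes> x) \<in> spn (E - {x})"
      using spn_scale[OF Ex _ i(1)] by simp
    moreover have "inv (d \<ominus> c) \<otimes> ((d \<ominus> c) \<otimes> x) = x"
      using i cc by (simp add: m_assoc[symmetric])
    ultimately show False using basis_indep x by (auto simp: lin_indep_def)
  qed
qed

lemma coord_ex:
  assumes x: "x \<in> E" and v: "v \<in> carrier L"
  shows "\<exists>c\<in>K. v \<ominus> c \<otimes> x \<in> spn (E - {x})"
proof -
  have xc: "x \<in> carrier L" using x basis_carrier by blast
  have Ex: "E - {x} \<subseteq> carrier L" using basis_carrier by blast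
  have "v \<in> spn E" using v basis_span by simp
  then show ?thesis
  proof induction
    case zero
    have "\<zero> \<ominus> \<zero> \<otimes> x = \<zero>" using xc by algebra
    then show ?case using spn.zero by force
  next
    case (step v c s)
    then obtain d where d: "d \<in> K" "v \<ominus> d \<otimes> x \<in> spn (E - {x})" by blast
    have cc: "c \<in> carrier L" "d \<in> carrier L" "v \<in> carrier L" "s \<in> carrier L"
      using step d basis_span basis_carrier by auto
    show ?case
    proof (cases "s = x")
      case True
      have "c \<otimes> s \<oplus> v \<ominus> (c \<oplus> d) \<otimes> x = v \<ominus> d \<otimes> x" using True cc xc by algebra
      then show ?thesis using d step by (intro bexI[of _ "c \<oplus> d"]) auto
    next
      case False
      have "c \<otimes> s \<oplus> v \<ominus> d \<otimes> x = c \<otimes> s \<oplus> (v \<ominus> d \<otimes> x)" using cc xc by algebra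
      then show ?thesis using d False step spn.step by (intro bexI[of _ d]) auto
    qed
  qed
qed

lemma coord_closed: "x \<in> E \<Longrightarrow> v \<in> carrier L \<Longrightarrow> coord E x v \<in> K"
  and coord_diff: "x \<in> E \<Longrightarrow> v \<in> carrier L \<Longrightarrow> v \<ominus> coord E x v \<otimes> x \<in> spn (E - {x})"
  using coord_ex coord_eqI by metis+

lemma coord_add:
  assumes x: "x \<in> E" and v: "v \<in> carrier L" "w \<in> carrier L"
  shows "coord E x (v \<oplus> w) = coord E x v \<oplus> coord E x w"
proof (rule coord_eqI[OF x])
  have Ex: "E - {x} \<subseteq> carrier L" using basis_carrier by blast
  have cc: "x \<in> carrier L" "coord E x v \<in> carrier L" "coord E x w \<in> carrier L"
    using x basis_carrier coord_closed v by auto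
  have "v \<oplus> w \<ominus> (coord E x v \<oplus> coord E x w) \<otimes> x = (v \<ominus> coord E x v \<otimes> x) \<oplus> (w \<ominus> coord E x w \<otimes> x)"
    using cc v by algebra
  then show "v \<oplus> w \<ominus> (coord E x v \<oplus> coord E x w) \<otimes> x \<in> spn (E - {x})"
    using spn_add[OF Ex coord_diff[OF x v(1)] coord_diff[OF x v(2)]] by simp
qed (use coord_closed x v in auto)

lemma coord_scale:
  assumes x: "x \<in> E" and v: "v \<in> carrier L" "k \<in> K"
  shows "coord E x (k \<otimes> v) = k \<otimes> coord E x v"
proof (rule coord_eqI[OF x])
  have Ex: "E - {x} \<subseteq> carrier L" using basis_carrier by blast
  have cc: "x \<in> carrier L" "coord E x v \<in> carrier L" "k \<in> carrier L"
    using x basis_carrier coord_closed v by auto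
  have "k \<otimes> v \<ominus> (k \<otimes> coord E x v) \<otimes> x = k \<otimes> (v \<ominus> coord E x v \<otimes> x)"
    using cc v by algebra
  then show "k \<otimes> v \<ominus> (k \<otimes> coord E x v) \<otimes> x \<in> spn (E - {x})"
    using spn_scale[OF Ex coord_diff[OF x v(1)]] v by simp
qed (use coord_closed x v in auto)

lemma coord_basis:
  assumes "x \<in> E" "y \<in> E"
  shows "coord E x y = (if x = y then \<one> else \<zero>)"
proof (rule coord_eqI[OF assms(1)])
  have Ex: "E - {x} \<subseteq> carrier L" using basis_carrier by blast
  have cc: "x \<in> carrier L" "y \<in> carrier L" using assms basis_carrier by auto
  have "y \<ominus> \<one> \<otimes> y = \<zero>" "y \<ominus> \<zero> \<otimes> x = y" using cc by algebra+
  then show "y \<ominus> (if x = y then \<one> else \<zero>) \<otimes> x \<in> spn (E - {x})"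
    using spn_base[OF Ex, of y] assms spn.zero by auto
qed (use assms basis_carrier in auto)

lemma finite_coord: "v \<in> carrier L \<Longrightarrow> finite {x \<in> E. coord E x v \<noteq> \<zero>}"
proof -
  assume "v \<in> carrier L"
  then have "v \<in> spn E" using basis_span by simp
  then show ?thesis
  proof induction
    case zero
    have "coord E x \<zero> = \<zero>" if "x \<in> E" for x
      using coord_scale[OF that zero_closed base_closed(1)] coord_closed[OF that zero_closed] by simp
    then have "{x \<in> E. coord E x \<zero> \<noteq> \<zero>} = {}" by blast
    then show ?case by (simp only: finite.emptyI)
  next
    case (step v c s)
    have cc: "c \<in> carrier L" "v \<in> carrier L" "s \<in> carrier L"
      using step basis_span basis_carrier by auto
    have "{x \<in> E. coord E x (c \<otimes> s \<oplus> v) \<noteq> \<zero>} \<subseteq> insert s {x \<in> E. coord E x v \<noteq> \<zero>}"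
      using cc step by (auto simp: coord_add coord_scale coord_basis)
    then show ?case using step finite_subset by blast
  qed
qed

text \<open>Allows the summation set to be enlarged, so that the values at two vectors can be added
  term by term over a common finite set.\<close>

lemma lin_extend_eq:
  assumes "f \<in> E \<rightarrow> carrier L" "v \<in> carrier L" "finite A" "A \<subseteq> E" "{x \<in> E. coord E x v \<noteq> \<zero>} \<subseteq> A"
  shows "lin_extend E f v = (\<Oplus>x \<in> A. coord E x v \<otimes> f x)"
  unfolding lin_extend_def
proof (rule add.finprod_mono_neutral_cong_left)
  show "coord E x v \<otimes> f x = \<zero>" if "x \<in> A - {x \<in> E. coord E x v \<noteq> \<zero>}" for x
    using that assms by (auto simp: Pi_iff subset_iff)
  show "(\<lambda>x. coord E x v \<otimes> f x) \<in> A \<rightarrow> carrier L"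
    using assms coord_closed by (auto simp: Pi_iff subset_iff)
qed (use assms in auto)

lemma K_linear_lin_extend:
  assumes f: "f \<in> E \<rightarrow> carrier L"
  shows "K_linear (lin_extend E f)"
  unfolding K_linear_def
proof (intro conjI ballI)
  have cl: "coord E x v \<otimes> f x \<in> carrier L" if "x \<in> E" "v \<in> carrier L" for x v
    using that f coord_closed by (auto simp: Pi_iff)
  show "lin_extend E f \<in> carrier L \<rightarrow> carrier L"
    unfolding lin_extend_def using cl by (auto intro!: finsum_closed)
  fix v assume v: "v \<in> carrier L"
  { fix w assume w: "w \<in> carrier L"
    let ?A = "{x \<in> E. coord E x v \<noteq> \<zero>} \<union> {x \<in> E. coord E x w \<noteq> \<zero>}"
    have A: "finite ?A" "?A \<subseteq> E" using finite_coord v w by auto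
    have "lin_extend E f (v \<oplus> w) = (\<Oplus>x \<in> ?A. coord E x (v \<oplus> w) \<otimes> f x)"
      using A v w by (intro lin_extend_eq[OF f]) (auto simp: coord_add)
    also have "\<dots> = (\<Oplus>x \<in> ?A. coord E x v \<otimes> f x \<oplus> coord E x w \<otimes> f x)"
      using v w f cl coord_closed
      by (intro add.finprod_cong') (auto simp: coord_add l_distr Pi_iff)
    also have "\<dots> = (\<Oplus>x \<in> ?A. coord E x v \<otimes> f x) \<oplus> (\<Oplus>x \<in> ?A. coord E x w \<otimes> f x)"
      using v w cl by (intro add.finprod_multf) auto
    also have "\<dots> = lin_extend E f v \<oplus> lin_extend E f w"
      using lin_extend_eq[OF f v A] lin_extend_eq[OF f w A] by simp
    finally show "lin_extend E f (v \<oplus> w) = lin_extend E f v \<oplus> lin_extend E f w" . }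
  fix k assume k: "k \<in> K"
  let ?A = "{x \<in> E. coord E x v \<noteq> \<zero>}"
  have A: "finite ?A" "?A \<subseteq> E" using finite_coord v by auto
  have "lin_extend E f (k \<otimes> v) = (\<Oplus>x \<in> ?A. coord E x (k \<otimes> v) \<otimes> f x)"
    using A v k by (intro lin_extend_eq[OF f]) (auto simp: coord_scale)
  also have "\<dots> = (\<Oplus>x \<in> ?A. k \<otimes> (coord E x v \<otimes> f x))"
    using v k f cl coord_closed
    by (intro add.finprod_cong') (auto simp: coord_scale m_assoc Pi_iff)
  also have "\<dots> = k \<otimes> lin_extend E f v"
    unfolding lin_extend_def using v k cl A by (intro finsum_rdistr[symmetric]) auto
  finally show "lin_extend E f (k \<otimes> v) = k \<otimes> lin_extend E f v" .
qed

lemma lin_extend_basis: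
  assumes f: "f \<in> E \<rightarrow> carrier L" and y: "y \<in> E"
  shows "lin_extend E f y = f y"
proof -
  have "lin_extend E f y = (\<Oplus>x \<in> {y}. coord E x y \<otimes> f x)"
    using f y basis_carrier by (intro lin_extend_eq) (auto simp: coord_basis split: if_splits)
  then show ?thesis using f y by (simp add: coord_basis Pi_iff)
qed

lemma K_linear_eq_on_basis:
  assumes "K_linear T" "K_linear U" "\<And>x. x \<in> E \<Longrightarrow> T x = U x" "v \<in> carrier L"
  shows "T v = U v"
  using K_linear_eq_on_spn[OF assms(1,2) basis_carrier assms(3)] assms(4) basis_span by simp

end

text \<open>The equation says that \<open>g\<close> is the commutator
  \<open>h \<otimes> k \<otimes> inv h \<otimes> inv k\<close>. Written without inverses it can be
  checked pointwise for maps.\<close>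

lemma (in group) commutator_in_derived:
  assumes "g \<in> carrier G" "h \<in> carrier G" "k \<in> carrier G" "g \<otimes> (k \<otimes> h) = h \<otimes> k"
  shows "g \<in> derived G (carrier G)"
proof -
  have "g = g \<otimes> (k \<otimes> h) \<otimes> inv (k \<otimes> h)" using assms(1-3) by (simp add: m_assoc)
  also have "\<dots> = h \<otimes> k \<otimes> inv h \<otimes> inv k"
    using assms(2,3) by (simp add: assms(4) inv_mult_group m_assoc)
  finally have "g \<in> derived_set G (carrier G)" using assms(2,3) by blast
  then show ?thesis unfolding derived_def by (rule generate.incl)
qed

context field_ext
begin

section \<open>The general linear group\<close>

lemma GL_carrier_iff: "f \<in> carrier (GL_ext L K) \<longleftrightarrow> f \<in> Bij (carrier L) \<and> K_linear f"
  using Bij_imp_funcset by (auto simp: GL_ext_def K_linear_def)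

lemma GL_mult:
  "f \<in> carrier (GL_ext L K) \<Longrightarrow> g \<in> carrier (GL_ext L K) \<Longrightarrow> v \<in> carrier L \<Longrightarrow>
    (f \<otimes>\<^bsub>GL_ext L K\<^esub> g) v = f (g v)"
  by (auto simp: GL_ext_def BijGroup_def compose_def)

lemma K_linear_inv_into:
  assumes f: "f \<in> Bij (carrier L)" "K_linear f"
  shows "K_linear (inv_into (carrier L) f)"
proof -
  let ?g = "inv_into (carrier L) f"
  have bij: "inj_on f (carrier L)" "f ` carrier L = carrier L"
    using f by (auto simp: Bij_def bij_betw_def)
  have g: "?g v \<in> carrier L" "f (?g v) = v" if "v \<in> carrier L" for v
    using that bij by (auto simp: inv_into_into f_inv_into_f)
  have eq: "?g w = v" if "v \<in> carrier L" "f v = w" for v w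
    using that bij by auto
  show ?thesis
    unfolding K_linear_def
    by (intro conjI ballI; (intro eq)?) (use g K_linearD(2,3)[OF f(2)] in auto)
qed

lemma subgroup_GL: "subgroup (carrier (GL_ext L K)) (BijGroup (carrier L))"
proof (rule group.subgroupI[OF group_BijGroup])
  show "carrier (GL_ext L K) \<subseteq> carrier (BijGroup (carrier L))"
    by (auto simp: GL_ext_def BijGroup_def)
  have "(\<lambda>x\<in>carrier L. x) \<in> carrier (GL_ext L K)"
    unfolding GL_carrier_iff using id_Bij K_linear_cong[OF K_linear_id] by auto
  then show "carrier (GL_ext L K) \<noteq> {}" by blast
  fix f assume f: "f \<in> carrier (GL_ext L K)"
  then have f': "f \<in> Bij (carrier L)" "K_linear f" by (auto simp: GL_carrier_iff)
  show "inv\<^bsub>BijGroup (carrier L)\<^esub> f \<in> carrier (GL_ext L K)"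
    unfolding inv_BijGroup[OF f'(1)] GL_carrier_iff
    using restrict_inv_into_Bij[OF f'(1)] K_linear_cong[OF K_linear_inv_into[OF f']] by auto
  fix g assume "g \<in> carrier (GL_ext L K)"
  then have g': "g \<in> Bij (carrier L)" "K_linear g" by (auto simp: GL_carrier_iff)
  have "f \<otimes>\<^bsub>BijGroup (carrier L)\<^esub> g = compose (carrier L) f g"
    using f' g' by (simp add: BijGroup_def)
  then show "f \<otimes>\<^bsub>BijGroup (carrier L)\<^esub> g \<in> carrier (GL_ext L K)"
    unfolding GL_carrier_iff using compose_Bij[OF f'(1) g'(1)]
      K_linear_cong[OF K_linear_comp[OF f'(2) g'(2)]] by (auto simp: compose_def)
qed

lemma group_GL: "group (GL_ext L K)"
proof -
  have "GL_ext L K = BijGroup (carrier L) \<lparr>carrier := carrier (GL_ext L K)\<rparr>"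
    by (simp add: GL_ext_def)
  then show ?thesis
    using group.subgroup_imp_group[OF group_BijGroup subgroup_GL] by simp
qed

lemma GL_ext_eqI:
  assumes "f \<in> carrier (GL_ext L K)" "g \<in> carrier (GL_ext L K)"
    and "\<And>v. v \<in> carrier L \<Longrightarrow> f v = g v"
  shows "f = g"
proof (rule extensionalityI[of _ "carrier L"])
  show "f \<in> extensional (carrier L)" "g \<in> extensional (carrier L)"
    using assms by (auto simp: GL_carrier_iff Bij_def)
qed (use assms in auto)

text \<open>Elements of \<open>Bij\<close> are undefined outside the carrier, hence the restriction.
  The inverse is supplied as an explicit linear map on all of \<open>L\<close>.\<close>

lemma restrict_in_GL:
  assumes "K_linear T" "K_linear U"
    and "\<And>v. v \<in> carrier L \<Longrightarrow> T (U v) = v" "\<And>v. v \<in> carrier L \<Longrightarrow> U (T v) = v"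
  shows "restrict T (carrier L) \<in> carrier (GL_ext L K)"
proof -
  have "bij_betw T (carrier L) (carrier L)"
    using assms K_linearD(1) by (intro bij_betw_byWitness[where f' = U]) auto
  then have "restrict T (carrier L) \<in> Bij (carrier L)"
    by (simp add: Bij_def bij_betw_restrict_eq)
  then show ?thesis
    using K_linear_cong[OF assms(1)] by (auto simp: GL_carrier_iff)
qed

lemma GL_commutator:
  assumes g: "g \<in> carrier (GL_ext L K)" and h: "h \<in> carrier (GL_ext L K)"
    and k: "k \<in> carrier (GL_ext L K)"
    and eq: "\<And>v. v \<in> carrier L \<Longrightarrow> g (k (h v)) = h (k v)"
  shows "g \<in> derived (GL_ext L K) (carrier (GL_ext L K))"
proof -
  interpret GL: group "GL_ext L K" by (rule group_GL)
  show ?thesis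
  proof (rule GL.commutator_in_derived[OF g h k], rule GL_ext_eqI)
    fix v assume v: "v \<in> carrier L"
    have "k v \<in> carrier L" "h v \<in> carrier L"
      using h k v by (auto simp: GL_carrier_iff K_linearD(1))
    then show "(g \<otimes>\<^bsub>GL_ext L K\<^esub> (k \<otimes>\<^bsub>GL_ext L K\<^esub> h)) v = (h \<otimes>\<^bsub>GL_ext L K\<^esub> k) v"
      using v eq g h k by (simp add: GL_mult)
  qed (use g h k in auto)
qed

end

section \<open>The Eilenberg swindle for a split basis\<close>

locale split_basis = field_ext_basis +
  fixes Y Z \<iota>
  assumes split: "E = Y \<union> Z" "Y \<inter> Z = {}"
    and iota_inj: "inj_on \<iota> (Z \<times> (UNIV :: int set))"
    and iota_0: "\<And>z. z \<in> Z \<Longrightarrow> \<iota> (z, 0) = z"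
    and iota_Y: "\<And>z k. z \<in> Z \<Longrightarrow> k \<noteq> 0 \<Longrightarrow> \<iota> (z, k) \<in> Y"
begin

lemma YZ_carrier: "Y \<subseteq> carrier L" "Z \<subseteq> carrier L"
  using split basis_carrier by auto

lemma iota_E: "z \<in> Z \<Longrightarrow> \<iota> (z, k) \<in> E"
  using iota_0 iota_Y split by (cases "k = 0") auto

text \<open>Here \<open>\<iota> (z, k)\<close> is the copy of \<open>z\<close> at level
  \<open>k\<close>: level 0 is \<open>Z\<close> itself, and all other levels are disjoint pieces of
  \<open>Y\<close>. The levels run over all integers so that moving up by one level is
  invertible.\<close>

definition tower :: "'a set" where "tower = \<iota> ` (Z \<times> UNIV)"

definition level :: "'a \<Rightarrow> 'a \<times> int" where "level = inv_into (Z \<times> UNIV) \<iota>"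

lemma level_iota: "z \<in> Z \<Longrightarrow> level (\<iota> (z, k)) = (z, k)"
  using iota_inj by (simp add: level_def)

lemma basis_cases:
  assumes "x \<in> E"
  obtains z k where "z \<in> Z" "x = \<iota> (z, k)" | "x \<in> Y" "x \<notin> tower"
  using assms split iota_0 by (cases "x \<in> tower") (force simp: tower_def)+

definition shift :: "int \<Rightarrow> 'a \<Rightarrow> 'a"
  where "shift k = lin_extend E
    (\<lambda>x. if x \<in> tower then \<iota> (fst (level x), k + snd (level x)) else x)"

lemma K_linear_shift: "K_linear (shift k)"
  and shift_iota: "z \<in> Z \<Longrightarrow> shift k (\<iota> (z, l)) = \<iota> (z, k + l)"
  and shift_other: "x \<in> E \<Longrightarrow> x \<notin> tower \<Longrightarrow> shift k x = x"
proof -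
  let ?f = "\<lambda>x. if x \<in> tower then \<iota> (fst (level x), k + snd (level x)) else x"
  have f: "?f \<in> E \<rightarrow> carrier L"
    using iota_E basis_carrier by (auto simp: tower_def level_iota subset_iff)
  show "K_linear (shift k)" unfolding shift_def by (rule K_linear_lin_extend[OF f])
  show "shift k (\<iota> (z, l)) = \<iota> (z, k + l)" if "z \<in> Z"
    unfolding shift_def lin_extend_basis[OF f iota_E[OF that]]
    using that by (auto simp: tower_def level_iota)
  show "shift k x = x" if "x \<in> E" "x \<notin> tower"
    unfolding shift_def lin_extend_basis[OF f that(1)] using that by simp
qed

lemma shift_add: "v \<in> carrier L \<Longrightarrow> shift k (shift l v) = shift (k + l) v"
proof (rule K_linear_eq_on_basis[OF K_linear_comp[OF K_linear_shift K_linear_shift] K_linear_shift])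
  fix x assume "x \<in> E"
  then show "shift k (shift l x) = shift (k + l) x"
    by (cases rule: basis_cases) (auto simp: shift_iota shift_other \<open>x \<in> E\<close> add.assoc)
qed

lemma shift_0: "v \<in> carrier L \<Longrightarrow> shift 0 v = v"
proof (rule K_linear_eq_on_basis[OF K_linear_shift K_linear_id])
  fix x assume "x \<in> E"
  then show "shift 0 x = x"
    by (cases rule: basis_cases) (auto simp: shift_iota shift_other \<open>x \<in> E\<close>)
qed

text \<open>When \<open>T\<close> preserves \<open>spn Z\<close>, this is the block diagonal
  operator with blocks \<open>T\<close> on the levels from 0 upwards and the identity on the
  remaining levels and outside the tower.\<close>

definition half :: "('a \<Rightarrow> 'a) \<Rightarrow> 'a \<Rightarrow> 'a"
  where "half T = lin_extend E
    (\<lambda>x. if x \<in> tower \<and> snd (level x) \<ge> 0 then shift (snd (level x)) (T (fst (level x))) else x)"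

context
  fixes T assumes T: "K_linear T"
begin

lemma K_linear_half: "K_linear (half T)"
  and half_nonneg: "z \<in> Z \<Longrightarrow> k \<ge> 0 \<Longrightarrow> half T (\<iota> (z, k)) = shift k (T z)"
  and half_neg: "z \<in> Z \<Longrightarrow> k < 0 \<Longrightarrow> half T (\<iota> (z, k)) = \<iota> (z, k)"
  and half_other: "x \<in> E \<Longrightarrow> x \<notin> tower \<Longrightarrow> half T x = x"
proof -
  let ?f = "\<lambda>x. if x \<in> tower \<and> snd (level x) \<ge> 0
    then shift (snd (level x)) (T (fst (level x))) else x"
  have "shift k (T z) \<in> carrier L" if "z \<in> Z" for k z
    using that K_linearD(1)[OF K_linear_shift K_linearD(1)[OF T]] YZ_carrier by blast
  then have f: "?f \<in> E \<rightarrow> carrier L"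
    using iota_E basis_carrier by (auto simp: tower_def level_iota)
  show "K_linear (half T)" unfolding half_def by (rule K_linear_lin_extend[OF f])
  show "half T (\<iota> (z, k)) = shift k (T z)" if "z \<in> Z" "k \<ge> 0"
    unfolding half_def lin_extend_basis[OF f iota_E[OF that(1)]]
    using that by (auto simp: tower_def level_iota)
  show "half T (\<iota> (z, k)) = \<iota> (z, k)" if "z \<in> Z" "k < 0"
    unfolding half_def lin_extend_basis[OF f iota_E[OF that(1)]]
    using that by (auto simp: tower_def level_iota)
  show "half T x = x" if "x \<in> E" "x \<notin> tower"
    unfolding half_def lin_extend_basis[OF f that(1)] using that by simp
qed

text \<open>Extends \<open>half_nonneg\<close> from the basis vectors to a whole level. This is
  needed to compose two such operators, because the inner one produces linear combinations of
  vectors of \<open>Z\<close>.\<close>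

lemma half_shift:
  assumes "k \<ge> 0" "w \<in> spn Z"
  shows "half T (shift k w) = shift k (T w)"
proof (rule K_linear_eq_on_spn[OF K_linear_comp[OF K_linear_half K_linear_shift]
      K_linear_comp[OF K_linear_shift T] YZ_carrier(2) _ assms(2)])
  fix z assume z: "z \<in> Z"
  then show "half T (shift k z) = shift k (T z)"
    using shift_iota[OF z, of k 0] half_nonneg[OF z assms(1)] iota_0[OF z] by simp
qed

end

lemma half_inverse:
  assumes T: "K_linear T" and U: "K_linear U" "\<And>z. z \<in> Z \<Longrightarrow> U z \<in> spn Z"
    and inv: "\<And>z. z \<in> Z \<Longrightarrow> T (U z) = z" and v: "v \<in> carrier L"
  shows "half T (half U v) = v"
proof (rule K_linear_eq_on_basis[OF K_linear_comp[OF K_linear_half[OF T] K_linear_half[OF U(1)]]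
      K_linear_id _ v])
  fix x assume x: "x \<in> E"
  then show "half T (half U x) = x"
  proof (cases rule: basis_cases)
    case (1 z k)
    show ?thesis
    proof (cases "k \<ge> 0")
      case True
      then have "half T (half U x) = shift k (T (U z))"
        using 1 half_nonneg[OF U(1)] half_shift[OF T True U(2)] by simp
      also have "\<dots> = x" using 1 inv shift_iota[of z k 0] iota_0 by simp
      finally show ?thesis .
    next
      case False
      then show ?thesis using 1 half_neg[OF U(1)] half_neg[OF T] by simp
    qed
  next
    case 2
    then show ?thesis using half_other[OF U(1) x] half_other[OF T x] by simp
  qed
qed

text \<open>
  The swindle: \<open>half T\<close> is the infinite product of the conjugates of \<open>T\<close> by the
  shifts of nonnegative degree, so conjugating it by one shift removes exactly one factor \<open>T\<close>.
\<close>

lemma block_in_derived: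
  assumes T: "K_linear T" "\<And>y. y \<in> Y \<Longrightarrow> T y = y" "\<And>z. z \<in> Z \<Longrightarrow> T z \<in> spn Z"
    and U: "K_linear U" "\<And>z. z \<in> Z \<Longrightarrow> U z \<in> spn Z"
    and TU: "\<And>v. v \<in> carrier L \<Longrightarrow> T (U v) = v" "\<And>v. v \<in> carrier L \<Longrightarrow> U (T v) = v"
  shows "restrict T (carrier L) \<in> derived (GL_ext L K) (carrier (GL_ext L K))"
proof -
  let ?r = "\<lambda>T. restrict T (carrier L)"
  have Zc: "z \<in> carrier L" if "z \<in> Z" for z using that YZ_carrier by blast
  have rT: "?r T \<in> carrier (GL_ext L K)" by (rule restrict_in_GL[OF T(1) U(1) TU])
  have rs: "?r (shift 1) \<in> carrier (GL_ext L K)"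
    by (rule restrict_in_GL[OF K_linear_shift[of 1] K_linear_shift[of "- 1"]])
      (simp_all add: shift_add shift_0)
  have rh: "?r (half T) \<in> carrier (GL_ext L K)"
    by (rule restrict_in_GL[OF K_linear_half[OF T(1)] K_linear_half[OF U(1)]
          half_inverse[OF T(1) U TU(1)] half_inverse[OF U(1) T(1,3) TU(2)]]) (auto intro: Zc)
  have fixY: "T w = w" if "w \<in> spn Y" for w
    using K_linear_eq_on_spn[OF T(1) K_linear_id YZ_carrier(1) T(2) that] .
  \<comment> \<open>This exhibits \<open>T\<close> as the commutator of \<open>half T\<close> and
    \<open>shift 1\<close>. It is enough to compare both sides on the basis.\<close>
  have comm: "T (shift 1 (half T v)) = half T (shift 1 v)" if v: "v \<in> carrier L" for v
  proof (rule K_linear_eq_on_basis[OF K_linear_comp[OF T(1) K_linear_comp[OF K_linear_shift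
          K_linear_half[OF T(1)]]] K_linear_comp[OF K_linear_half[OF T(1)] K_linear_shift] _ v])
    fix x assume x: "x \<in> E"
    then show "T (shift 1 (half T x)) = half T (shift 1 x)"
    proof (cases rule: basis_cases)
      case (1 z k)
      have Tz: "T z \<in> carrier L" using 1 K_linearD(1)[OF T(1)] Zc by blast
      have sx: "shift 1 x = \<iota> (z, 1 + k)" using 1 shift_iota by simp
      \<comment> \<open>After the shift the level is positive, zero or negative. On nonzero levels
        the outer \<open>T\<close> is the identity, since they lie in \<open>Y\<close>. The start
        \<open>k = - 1\<close> lands in level 0, where the outer \<open>T\<close> supplies the
        factor that \<open>half T\<close> did not yet apply at level -1.\<close>
      consider "k \<ge> 0" | "k = - 1" | "k < - 1" by linarith
      then show ?thesis
      proof cases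
        case a: 1
        have "shift (1 + k) (T z) \<in> spn Y"
        proof (rule K_linear_image_spn[OF K_linear_shift YZ_carrier(2) subspace_spn[OF YZ_carrier(1)]
              _ T(3)[OF 1(1)]])
          fix z' assume z': "z' \<in> Z"
          have "shift (1 + k) z' = \<iota> (z', 1 + k)"
            using shift_iota[OF z', of "1 + k" 0] iota_0[OF z'] by simp
          then show "shift (1 + k) z' \<in> spn Y"
            using spn_base[OF YZ_carrier(1)] iota_Y[OF z', of "1 + k"] a by simp
        qed
        then show ?thesis
          unfolding sx using 1 a half_nonneg[OF T(1)] Tz fixY by (simp add: shift_add)
      next
        case a: 2
        have "half T x = x" "shift 1 x = z" using 1 a half_neg[OF T(1)] iota_0 sx by auto
        moreover have "half T z = T z"
          using half_nonneg[OF T(1) 1(1), of 0] iota_0[OF 1(1)] Tz shift_0 by simp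
        ultimately show ?thesis by simp
      next
        case a: 3
        have "half T x = x" "half T (shift 1 x) = shift 1 x"
          using 1 a half_neg[OF T(1) 1(1)] sx by auto
        moreover have "T (shift 1 x) = shift 1 x"
          unfolding sx using iota_Y[OF 1(1)] a by (intro T(2)) simp
        ultimately show ?thesis by simp
      qed
    next
      case 2
      then show ?thesis using half_other[OF T(1) x] shift_other[OF x] T(2) by simp
    qed
  qed
  have cl: "half T v \<in> carrier L" "shift 1 v \<in> carrier L" if "v \<in> carrier L" for v
    using that K_linearD(1)[OF K_linear_half[OF T(1)]] K_linearD(1)[OF K_linear_shift] by auto
  show ?thesis
    by (rule GL_commutator[OF rT rh rs]) (simp add: cl comm)
qed

text \<open>Relative to \<open>F\<close> and the complement \<open>spn Z\<close>, the map
  \<open>\<phi>\<close> is block upper triangular with identity block on \<open>F\<close>. It equals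
  \<open>t \<one>\<close> after \<open>d\<close>, where \<open>d\<close> keeps the diagonal blocks
  and \<open>t \<one>\<close> is unipotent; the swindle handles \<open>d\<close>, and scaling
  \<open>F\<close> by \<open>x\<close> handles \<open>t \<one>\<close>.\<close>

lemma pointwise_stabilizer_in_derived:
  assumes F: "spn Y = F" "subfield F L" and x: "x \<in> F" "x \<noteq> \<zero>" "x \<noteq> \<one>"
    and \<phi>: "\<phi> \<in> carrier (GL_ext L K)" "\<And>f. f \<in> F \<Longrightarrow> \<phi> f = f"
  shows "\<phi> \<in> derived (GL_ext L K) (carrier (GL_ext L K))"
proof -
  interpret GL: group "GL_ext L K" by (rule group_GL)
  let ?r = "\<lambda>T. restrict T (carrier L)"
  define \<psi> where "\<psi> = inv_into (carrier L) \<phi>"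
  have \<phi>B: "\<phi> \<in> Bij (carrier L)" and \<phi>l: "K_linear \<phi>" using \<phi>(1) by (auto simp: GL_carrier_iff)
  have \<psi>l: "K_linear \<psi>" unfolding \<psi>_def by (rule K_linear_inv_into[OF \<phi>B \<phi>l])
  have inj: "inj_on \<phi> (carrier L)" "\<phi> ` carrier L = carrier L"
    using \<phi>B by (auto simp: Bij_def bij_betw_def)
  have \<psi>\<phi>: "\<psi> (\<phi> v) = v" and \<phi>\<psi>: "\<phi> (\<psi> v) = v" if "v \<in> carrier L" for v
    using that inj by (auto simp: \<psi>_def f_inv_into_f)
  have Fsub: "subspace F" using F(1) subspace_spn[OF YZ_carrier(1)] by simp
  have Fc: "f \<in> carrier L" if "f \<in> F" for f using that Fsub by (auto simp: subspace_def)
  have Fmult: "f \<otimes> g \<in> F" if "f \<in> F" "g \<in> F" for f g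
    using that subringE(6)[OF subfieldE(1)[OF F(2)]] by blast
  have \<psi>F: "\<psi> f = f" if "f \<in> F" for f using \<phi>(2)[OF that] \<psi>\<phi>[OF Fc[OF that]] by simp

  \<comment> \<open>\<open>q\<close> is the projection onto \<open>spn Z\<close> along
    \<open>F\<close>, and \<open>p\<close> below is the complementary projection onto
    \<open>F\<close>.\<close>
  define q where "q = lin_extend E (\<lambda>e. if e \<in> Z then e else \<zero>)"
  have qf: "(\<lambda>e. if e \<in> Z then e else \<zero>) \<in> E \<rightarrow> carrier L" using YZ_carrier by auto
  have ql: "K_linear q" unfolding q_def by (rule K_linear_lin_extend[OF qf])
  have qE: "q e = (if e \<in> Z then e else \<zero>)" if "e \<in> E" for e
    unfolding q_def by (rule lin_extend_basis[OF qf that])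
  define p where "p v = v \<ominus> q v" for v
  have pl: "K_linear p" unfolding p_def by (rule K_linear_diff[OF K_linear_id ql])
  have Zsub: "subspace (spn Z)" by (rule subspace_spn[OF YZ_carrier(2)])
  have qZ: "q v \<in> spn Z" if "v \<in> carrier L" for v
    using K_linear_image_spn[OF ql basis_carrier Zsub, of v] that qE basis_span
      spn_base[OF YZ_carrier(2)] spn.zero by auto
  have qF: "q f = \<zero>" if "f \<in> F" for f
  proof -
    have "q y \<in> {\<zero>}" if "y \<in> Y" for y using that qE[of y] split by auto
    moreover have "subspace {\<zero>}" by (simp add: subspace_def)
    ultimately have "q f \<in> {\<zero>}"
      using K_linear_image_spn[OF ql YZ_carrier(1)] that F(1) by blast
    then show ?thesis by simp
  qed
  have pc: "p v \<in> carrier L" and qc: "q v \<in> carrier L" and \<phi>c: "\<phi> v \<in> carrier L"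
    and \<psi>c: "\<psi> v \<in> carrier L" if "v \<in> carrier L" for v
    using that K_linearD(1)[OF pl] K_linearD(1)[OF ql] K_linearD(1)[OF \<phi>l] K_linearD(1)[OF \<psi>l]
    by auto
  have pF: "p f = f" if "f \<in> F" for f using qF[OF that] Fc[OF that] by (simp add: p_def a_minus_def)
  have pE: "p e = (if e \<in> Z then \<zero> else e)" if "e \<in> E" for e
  proof -
    have "e \<in> carrier L" using that basis_carrier by blast
    then show ?thesis using qE[OF that] by (auto simp: p_def a_minus_def r_neg)
  qed
  have "p e \<in> F" if "e \<in> E" for e
    using pE[OF that] that split F(1) spn_base[OF YZ_carrier(1)] spn.zero by auto
  then have pinF: "p v \<in> F" if "v \<in> carrier L" for v
    using K_linear_image_spn[OF pl basis_carrier Fsub] that basis_span by blast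
  have pq: "p v \<oplus> q v = v" if "v \<in> carrier L" for v
    using that qc[OF that] by (simp add: p_def a_minus_def a_assoc l_neg)
  have qp: "q (p v) = \<zero>" if "v \<in> carrier L" for v using qF pinF that by blast
  have qm: "q v = v \<ominus> p v" if "v \<in> carrier L" for v
    using that qc[OF that] unfolding p_def by algebra

  \<comment> \<open>\<open>d\<close> and \<open>d'\<close> are the block diagonal parts of
    \<open>\<phi>\<close> and its inverse \<open>\<psi>\<close>. They are mutually inverse because
    both maps are block triangular.\<close>
  define d where "d v = p v \<oplus> q (\<phi> v)" for v
  define d' where "d' v = p v \<oplus> q (\<psi> v)" for v
  have dl: "K_linear d" unfolding d_def by (rule K_linear_add[OF pl K_linear_comp[OF ql \<phi>l]])
  have d'l: "K_linear d'" unfolding d'_def by (rule K_linear_add[OF pl K_linear_comp[OF ql \<psi>l]])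
  \<comment> \<open>Stated for arbitrary \<open>T\<close> and \<open>U\<close> so that both
    compositions of \<open>d\<close> and \<open>d'\<close> are instances. Since \<open>T\<close>
    fixes \<open>F\<close>, it sends \<open>u\<close> to \<open>v\<close> up to terms in
    \<open>F\<close>, which \<open>q\<close> annihilates.\<close>
  have block_inverse: "(p u \<oplus> q (T u)) = v"
    if "u = p v \<oplus> q (U v)" "v \<in> carrier L" "K_linear T" "K_linear U" "\<And>f. f \<in> F \<Longrightarrow> T f = f"
      "\<And>v. v \<in> carrier L \<Longrightarrow> T (U v) = v" for u v T U
  proof -
    have Uc: "U v \<in> carrier L" and cl: "p v \<in> carrier L" "p (U v) \<in> carrier L" "q (U v) \<in> carrier L"
      using K_linearD(1)[OF that(4)] pc qc that(2) by auto
    have pqU: "p (q (U v)) = \<zero>"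
      using qm[OF Uc] K_linear_minus[OF pl Uc cl(2)] pF[OF pinF[OF Uc]] cl(2)
      by (simp add: a_minus_def r_neg)
    have "p u = p v"
      using that(1) K_linearD(2)[OF pl cl(1,3)] pqU pF[OF pinF[OF that(2)]] cl by simp
    moreover have "T u = p v \<oplus> (v \<ominus> p (U v))"
      using that(1) that(6)[of v] that(2) K_linearD(2)[OF that(3) cl(1,3)] that(5)[OF pinF[OF that(2)]]
        qm[OF Uc] K_linear_minus[OF that(3) Uc cl(2)] that(5)[OF pinF[OF Uc]] by simp
    then have "q (T u) = q v"
      using K_linearD(2)[OF ql cl(1), of "v \<ominus> p (U v)"] K_linear_minus[OF ql that(2) cl(2)]
        qp[OF that(2)] qp[OF Uc] qc[OF that(2)] that(2) cl by (simp add: a_minus_def)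
    ultimately show ?thesis using pq[OF that(2)] by simp
  qed
  have dd': "d (d' v) = v" and d'd: "d' (d v) = v" if "v \<in> carrier L" for v
    using block_inverse[OF d'_def that \<phi>l \<psi>l \<phi>(2) \<phi>\<psi>] block_inverse[OF d_def that \<psi>l \<phi>l \<psi>F \<psi>\<phi>]
    by (auto simp: d_def d'_def)
  have dY: "d y = y" if "y \<in> Y" for y
  proof -
    have "y \<in> F" using spn_base[OF YZ_carrier(1) that] F(1) by simp
    then show ?thesis using pF \<phi>(2) qF Fc by (simp add: d_def)
  qed
  have pZ: "p z = \<zero>" if "z \<in> Z" for z using pE[of z] split that by auto
  have dZ: "d z \<in> spn Z" and d'Z: "d' z \<in> spn Z" if "z \<in> Z" for z
  proof -
    have "z \<in> carrier L" using that YZ_carrier by blast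
    then show "d z \<in> spn Z" "d' z \<in> spn Z"
      using pZ[OF that] qZ[OF \<phi>c] qZ[OF \<psi>c] qc[OF \<phi>c] qc[OF \<psi>c] by (simp_all add: d_def d'_def)
  qed
  have d_der: "?r d \<in> derived (GL_ext L K) (carrier (GL_ext L K))"
    by (rule block_in_derived[OF dl dY dZ d'l d'Z dd' d'd])

  \<comment> \<open>This is the off-diagonal block of \<open>\<phi>\<close> following the inverse of
    its diagonal block on the complement. Expressing it through \<open>\<psi>\<close> makes it a
    linear map on all of \<open>L\<close> that kills \<open>F\<close> and takes values in
    \<open>F\<close>.\<close>
  define b where "b v = p (v \<ominus> \<psi> v)" for v
  have bl: "K_linear b" unfolding b_def
    by (rule K_linear_comp[OF pl K_linear_diff[OF K_linear_id \<psi>l]])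
  have bc: "b v \<in> carrier L" if "v \<in> carrier L" for v using K_linearD(1)[OF bl that] .
  have binF: "b v \<in> F" if "v \<in> carrier L" for v
    using pinF[of "v \<ominus> \<psi> v"] \<psi>c that by (simp add: b_def)
  have bF: "b f = \<zero>" if "f \<in> F" for f
    using \<psi>F[OF that] Fc[OF that] K_linear_zero[OF pl] by (simp add: b_def a_minus_def r_neg)
  \<comment> \<open>Multiplication by \<open>x\<close> on \<open>F\<close>, extended by the identity on the complement, makes
    the transvection \<open>1 + b\<close> a commutator because \<open>x - 1\<close> is invertible.\<close>
  define c where "c = inv (x \<ominus> \<one>)"
  have xc: "x \<in> carrier L" using Fc x by blast
  have one: "\<one> \<in> F" using subringE(3)[OF subfieldE(1)[OF F(2)]] .
  have x1: "x \<ominus> \<one> \<noteq> \<zero>" using x(3) xc by (simp add: r_right_minus_eq)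
  have x1F: "x \<ominus> \<one> \<in> F" using subspace_minus[OF Fsub x(1) one] .
  have cF: "c \<in> F" unfolding c_def using subfield_m_inv(1)[OF F(2)] x1 x1F by blast
  have cx: "c \<otimes> (x \<ominus> \<one>) = \<one>" unfolding c_def using x1 xc field_Units by auto
  have ixF: "inv x \<in> F" using subfield_m_inv(1)[OF F(2)] x by blast
  have ix: "inv x \<otimes> x = \<one>" "x \<otimes> inv x = \<one>" using x(2) xc field_Units by auto
  note cc = Fc[OF cF] and ixc = Fc[OF ixF]
  define m where "m y v = v \<oplus> (y \<ominus> \<one>) \<otimes> p v" for y v
  \<comment> \<open>The maps \<open>t y\<close> compose by adding parameters because
    \<open>b\<close> vanishes on its own values, and the maps \<open>m y\<close> compose by
    multiplying them. Thus negatives and inverses of parameters in \<open>F\<close> give inverse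
    maps.\<close>
  define t where "t y v = v \<oplus> y \<otimes> b v" for y v
  have ml: "K_linear (m y)" if "y \<in> carrier L" for y
    unfolding m_def using that by (intro K_linear_add[OF K_linear_id K_linear_mult[OF _ pl]]) simp
  have tl: "K_linear (t y)" if "y \<in> carrier L" for y
    unfolding t_def using that by (intro K_linear_add[OF K_linear_id K_linear_mult[OF _ bl]]) simp
  have F1: "y \<ominus> \<one> \<in> F" if "y \<in> F" for y using subspace_minus[OF Fsub that one] .
  have pm: "p (m y v) = y \<otimes> p v" if "y \<in> F" "v \<in> carrier L" for y v
  proof -
    have "p (m y v) = p v \<oplus> (y \<ominus> \<one>) \<otimes> p v"
      using K_linearD(2)[OF pl that(2)] Fmult[OF F1[OF that(1)] pinF[OF that(2)]] Fc pF
      by (simp add: m_def)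
    then show ?thesis using Fc[OF that(1)] pc[OF that(2)] by (simp, algebra)
  qed
  have bm: "b (m y v) = b v" if "y \<in> F" "v \<in> carrier L" for y v
    using K_linearD(2)[OF bl that(2)] Fmult[OF F1[OF that(1)] pinF[OF that(2)]] Fc bF bc[OF that(2)]
    by (simp add: m_def)
  have bt: "b (t y v) = b v" if "y \<in> F" "v \<in> carrier L" for y v
    using K_linearD(2)[OF bl that(2)] Fmult[OF that(1) binF[OF that(2)]] Fc bF bc[OF that(2)]
    by (simp add: t_def)
  have pt: "p (t y v) = p v \<oplus> y \<otimes> b v" if "y \<in> F" "v \<in> carrier L" for y v
    using K_linearD(2)[OF pl that(2)] Fmult[OF that(1) binF[OF that(2)]] Fc pF
    by (simp add: t_def)
  have mm: "m y (m y' v) = v" if "y \<in> F" "y' \<in> F" "y \<otimes> y' = \<one>" "v \<in> carrier L" for y y' v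
  proof -
    have c: "y \<in> carrier L" "y' \<in> carrier L" "p v \<in> carrier L" using that Fc pc by auto
    have "m y (m y' v) = v \<oplus> (y' \<ominus> \<one>) \<otimes> p v \<oplus> (y \<ominus> \<one>) \<otimes> (y' \<otimes> p v)"
      using pm[OF that(2,4)] by (simp add: m_def[of y] m_def[of y' v])
    also have "\<dots> = v \<oplus> (y \<otimes> y' \<ominus> \<one>) \<otimes> p v" using c that(4) by algebra
    finally show ?thesis using that c by (simp add: a_minus_def r_neg)
  qed
  have tt: "t y (t y' v) = v" if "y \<in> F" "y' \<in> F" "y' \<oplus> y = \<zero>" "v \<in> carrier L" for y y' v
  proof -
    have c: "y \<in> carrier L" "y' \<in> carrier L" "b v \<in> carrier L" using that Fc bc by auto
    have "t y (t y' v) = v \<oplus> y' \<otimes> b v \<oplus> y \<otimes> b v"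
      using bt[OF that(2,4)] by (simp add: t_def[of y] t_def[of y' v])
    also have "\<dots> = v \<oplus> (y' \<oplus> y) \<otimes> b v" using c that(4) by algebra
    finally show ?thesis using that c by simp
  qed
  have neg: "\<ominus> y \<in> F" if "y \<in> F" for y
    using that subringE(5)[OF subfieldE(1)[OF F(2)]] by blast
  have rt: "?r (t y) \<in> carrier (GL_ext L K)" if "y \<in> F" for y
    using Fc neg that by (intro restrict_in_GL[OF tl tl, of y "\<ominus> y"] tt) (auto simp: l_neg r_neg)
  have rm: "?r (m x) \<in> carrier (GL_ext L K)"
    using ix x(1) ixF xc ixc by (intro restrict_in_GL[OF ml ml, of x "inv x"] mm) auto
  \<comment> \<open>Conjugation by \<open>m x\<close> turns \<open>t y\<close> into
    \<open>t (x \<otimes> y)\<close>. The claim therefore reduces to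
    \<open>\<one> \<ominus> x \<otimes> c = \<ominus> c\<close>, which is the defining property of
    \<open>c\<close>.\<close>
  have comm: "t \<one> (m x (t (\<ominus> c) v)) = t (\<ominus> c) (m x v)" if v: "v \<in> carrier L" for v
  proof -
    have c: "c \<in> carrier L" "b v \<in> carrier L" "p v \<in> carrier L" "\<ominus> c \<in> carrier L"
      using cc bc pc v by auto
    have tcv: "t (\<ominus> c) v \<in> carrier L" using c v by (simp add: t_def)
    have "t \<one> (m x (t (\<ominus> c) v)) =
        t (\<ominus> c) v \<oplus> (x \<ominus> \<one>) \<otimes> (p v \<oplus> (\<ominus> c) \<otimes> b v) \<oplus> \<one> \<otimes> b v"
      using bm[OF x(1) tcv] bt[OF neg[OF cF] v] pt[OF neg[OF cF] v]
      by (simp add: t_def[of \<one>] m_def[of x])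
    also have "\<dots> = v \<oplus> (\<ominus> c) \<otimes> b v \<oplus> (x \<ominus> \<one>) \<otimes> p v \<oplus> (\<one> \<ominus> c \<otimes> (x \<ominus> \<one>)) \<otimes> b v"
      unfolding t_def using c v xc by algebra
    also have "\<dots> = v \<oplus> (x \<ominus> \<one>) \<otimes> p v \<oplus> (\<ominus> c) \<otimes> b v"
      unfolding cx using c v xc by algebra
    also have "\<dots> = t (\<ominus> c) (m x v)"
      using bm[OF x(1) v] by (simp add: t_def m_def)
    finally show ?thesis .
  qed
  have tcl: "t y v \<in> carrier L" if "y \<in> F" "v \<in> carrier L" for y v
    using K_linearD(1)[OF tl[OF Fc[OF that(1)]] that(2)] .
  have t_der: "?r (t \<one>) \<in> derived (GL_ext L K) (carrier (GL_ext L K))"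
    by (rule GL_commutator[OF rt[OF one] rt[OF neg[OF cF]] rm])
      (use comm tcl[OF neg[OF cF]] K_linearD(1)[OF ml[OF xc]] in auto)

  have rd: "?r d \<in> carrier (GL_ext L K)" by (rule restrict_in_GL[OF dl d'l dd' d'd])
  have "\<phi> = ?r (t \<one>) \<otimes>\<^bsub>GL_ext L K\<^esub> ?r d"
  proof (rule GL_ext_eqI[OF \<phi>(1) GL.m_closed[OF rt[OF one] rd]])
    fix v assume v: "v \<in> carrier L"
    have s: "\<phi> v \<in> carrier L" using \<phi>c v .
    have c: "p v \<in> carrier L" "q (\<phi> v) \<in> carrier L" "p (\<phi> v) \<in> carrier L" "d v \<in> carrier L"
      using pc qc s v K_linearD(1)[OF dl] by auto
    \<comment> \<open>Since \<open>\<psi>\<close> fixes the values of \<open>p\<close>, the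
      difference of \<open>d v\<close> and \<open>\<psi> (d v)\<close> is
      \<open>\<phi> v \<ominus> v\<close>. Hence \<open>b (d v)\<close> is exactly the correction in
      \<open>F\<close> by which \<open>d v\<close> differs from \<open>\<phi> v\<close>.\<close>
    have "\<psi> (d v) = p v \<oplus> (v \<ominus> p (\<phi> v))"
      using K_linearD(2)[OF \<psi>l c(1,2)] \<psi>F[OF pinF[OF v]] qm[OF s] K_linear_minus[OF \<psi>l s c(3)]
        \<psi>F[OF pinF[OF s]] \<psi>\<phi>[OF v] by (simp add: d_def)
    moreover have "d v = p v \<oplus> (\<phi> v \<ominus> p (\<phi> v))" using qm[OF s] by (simp add: d_def)
    ultimately have "d v \<ominus> \<psi> (d v) = (p v \<oplus> (\<phi> v \<ominus> p (\<phi> v))) \<ominus> (p v \<oplus> (v \<ominus> p (\<phi> v)))"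
      by simp
    also have "\<dots> = \<phi> v \<ominus> v" using c s v by algebra
    finally have "b (d v) = p (\<phi> v) \<ominus> p v"
      using K_linear_minus[OF pl s v] by (simp add: b_def)
    then have "t \<one> (d v) = p v \<oplus> (\<phi> v \<ominus> p (\<phi> v)) \<oplus> \<one> \<otimes> (p (\<phi> v) \<ominus> p v)"
      using qm[OF s] by (simp add: t_def d_def)
    also have "\<dots> = \<phi> v" using c s v by algebra
    finally show "\<phi> v = (?r (t \<one>) \<otimes>\<^bsub>GL_ext L K\<^esub> ?r d) v"
      using v c by (simp add: GL_mult[OF rt[OF one] rd])
  qed
  then show ?thesis
    using subgroup.m_closed[OF GL.derived_is_subgroup[OF subset_refl] t_der d_der] by simp
qed

end

section \<open>Cardinality\<close>

lemma finite_ordLeq_infinite: "finite A \<Longrightarrow> infinite C \<Longrightarrow> |A| \<le>o |C|"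
  using ordLess_imp_ordLeq[OF finite_ordLess_infinite2] .

lemma card_of_Un_infinite_bound:
  "infinite C \<Longrightarrow> |A| \<le>o |C| \<Longrightarrow> |B| \<le>o |C| \<Longrightarrow> |A \<union> B| \<le>o |C|"
  using card_of_Un_ordLeq_infinite by blast

lemma card_of_image_bound: "|A| \<le>o |C| \<Longrightarrow> |f ` A| \<le>o |C|"
  using card_of_image ordLeq_transitive by blast

lemma card_of_Times_infinite_bound:
  "infinite C \<Longrightarrow> |A| \<le>o |C| \<Longrightarrow> |B| \<le>o |C| \<Longrightarrow> |A \<times> B| \<le>o |C|"
  using card_of_Sigma_ordLeq_infinite[of C A "\<lambda>_. B"] by blast

lemma card_of_countable_UN_bound:
  fixes A :: "nat \<Rightarrow> 'a set"
  assumes "infinite C" "\<And>n. |A n| \<le>o |C|"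
  shows "|\<Union>n. A n| \<le>o |C|"
  using assms card_of_UNION_ordLeq_infinite[of C UNIV A] by (simp add: infinite_iff_card_of_nat)

lemma card_of_lists_bound:
  fixes A :: "'a set"
  assumes "infinite C" "|A| \<le>o |C|"
  shows "|lists A| \<le>o |C|"
proof -
  have "|{xs \<in> lists A. length xs = n}| \<le>o |C|" for n
  proof (induction n)
    case 0
    have "{xs \<in> lists A. length xs = 0} = {[]}" by auto
    moreover have "|{[] :: 'a list}| \<le>o |C|" by (rule finite_ordLeq_infinite[OF _ assms(1)]) simp
    ultimately show ?case by (simp only:)
  next
    case (Suc n)
    have "{xs \<in> lists A. length xs = Suc n} \<subseteq> case_prod Cons ` (A \<times> {xs \<in> lists A. length xs = n})"
      by (auto simp: length_Suc_conv)
    then show ?case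
      using card_of_image_bound[OF card_of_Times_infinite_bound[OF assms Suc.IH], of "case_prod Cons"]
        card_of_mono1 ordLeq_transitive by blast
  qed
  then have "|\<Union>n. {xs \<in> lists A. length xs = n}| \<le>o |C|"
    by (rule card_of_countable_UN_bound[OF assms(1)])
  moreover have "(\<Union>n. {xs \<in> lists A. length xs = n}) = lists A" by auto
  ultimately show ?thesis by (simp only:)
qed

text \<open>The generated field is exhausted by countably many stages, each of which adds the
  results of one field operation and so preserves an infinite bound.\<close>

lemma card_of_generate_field_bound:
  fixes L (structure)
  assumes "infinite C" "|H| \<le>o |C|"
  shows "|generate_field L H| \<le>o |C|"
proof -
  \<comment> \<open>Only an upper bound is wanted, so \<open>m_inv\<close> may be applied to zero as
    well.\<close>
  define step where "step A = A \<union> a_inv L ` A \<union> m_inv L ` A \<union>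
    case_prod (add L) ` (A \<times> A) \<union> case_prod (monoid.mult L) ` (A \<times> A)" for A
  define S where "S n = (step ^^ n) (insert \<one> H)" for n
  have S_Suc: "S (Suc n) = step (S n)" for n by (simp add: S_def)
  have "|S n| \<le>o |C|" for n
  proof (induction n)
    case 0
    have "|{\<one>} \<union> H| \<le>o |C|"
      by (intro card_of_Un_infinite_bound finite_ordLeq_infinite assms) simp
    then show ?case by (simp add: S_def)
  next
    case (Suc n)
    then show ?case
      unfolding S_Suc step_def
      by (intro card_of_Un_infinite_bound card_of_image_bound card_of_Times_infinite_bound assms)
  qed
  then have bound: "|\<Union>n. S n| \<le>o |C|" using card_of_countable_UN_bound[OF assms(1)] by blast
  \<comment> \<open>Monotonicity brings the two arguments of a sum or product into a common
    stage.\<close>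
  have mono: "S m \<subseteq> S n" if "m \<le> n" for m n
    using that by (rule lift_Suc_mono_le[rotated]) (auto simp: S_Suc step_def)
  have "h \<in> (\<Union>n. S n)" if "h \<in> generate_field L H" for h
    using that
  proof induction
    case one
    have "\<one> \<in> S 0" by (simp add: S_def)
    then show ?case by blast
  next
    case (incl h)
    then have "h \<in> S 0" by (simp add: S_def)
    then show ?case by blast
  next
    case (a_inv h)
    then obtain n where "h \<in> S n" by blast
    then have "\<ominus> h \<in> S (Suc n)" by (simp add: S_Suc step_def)
    then show ?case by blast
  next
    case (m_inv h)
    then obtain n where "h \<in> S n" by blast
    then have "inv h \<in> S (Suc n)" by (simp add: S_Suc step_def)
    then show ?case by blast
  next
    case (eng_add g h)
    then obtain n k where "g \<in> S n" "h \<in> S k" by blast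
    then have "g \<in> S (max n k)" "h \<in> S (max n k)" using mono by (meson max.cobounded1 max.cobounded2 subsetD)+
    then have "g \<oplus> h \<in> S (Suc (max n k))" unfolding S_Suc step_def by (auto simp: image_iff)
    then show ?case by blast
  next
    case (eng_mult g h)
    then obtain n k where "g \<in> S n" "h \<in> S k" by blast
    then have "g \<in> S (max n k)" "h \<in> S (max n k)" using mono by (meson max.cobounded1 max.cobounded2 subsetD)+
    then have "g \<otimes> h \<in> S (Suc (max n k))" unfolding S_Suc step_def by (auto simp: image_iff)
    then show ?case by blast
  qed
  then have "generate_field L H \<subseteq> (\<Union>n. S n)" by blast
  then show ?thesis by (rule ordLeq_transitive[OF card_of_mono1 bound])
qed

context field_ext
begin

text \<open>Polynomials over \<open>F\<close> are lists over \<open>F\<close>, so there are at most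
  \<open>|C|\<close> of them, and each has finitely many roots. These roots exhaust
  \<open>L\<close>.\<close>

lemma card_of_algebraic_bound:
  assumes "infinite C" "subfield F L" "|F| \<le>o |C|" "algebraic_over L F"
  shows "|carrier L| \<le>o |C|"
proof -
  let ?R = "\<lambda>p. {x. is_root p x}"
  have sF: "subring F L" using subfieldE(1)[OF assms(2)] .
  have Fc: "F \<subseteq> carrier L" using subringE(1)[OF sF] .
  have sub: "carrier (F[X]) \<subseteq> lists F" "carrier (F[X]) \<subseteq> carrier (poly_ring L)"
    using Fc by (auto simp: univ_poly_def polynomial_def)
  have "|carrier (F[X])| \<le>o |C|"
    using card_of_mono1[OF sub(1)] card_of_lists_bound[OF assms(1,3)] ordLeq_transitive by blast
  moreover have "\<forall>p\<in>carrier (F[X]). |?R p| \<le>o |C|"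
    using sub(2) finite_number_of_roots finite_ordLeq_infinite[OF _ assms(1)] by blast
  ultimately have "|\<Union>p\<in>carrier (F[X]). ?R p| \<le>o |C|"
    by (rule card_of_UNION_ordLeq_infinite[OF assms(1)])
  moreover have "carrier L \<subseteq> (\<Union>p\<in>carrier (F[X]). ?R p)"
  proof
    fix x assume x: "x \<in> carrier L"
    then have "(algebraic over F) x" using assms(4) by (simp add: algebraic_over_def over_def)
    then obtain p where "p \<in> carrier (F[X])" "p \<noteq> []" "eval p x = \<zero>"
      using algebraicE[OF sF x] by blast
    then show "x \<in> (\<Union>p\<in>carrier (F[X]). ?R p)" using x by (auto simp: is_root_def)
  qed
  ultimately show ?thesis using ordLeq_transitive[OF card_of_mono1] by metis
qed

lemma card_of_finite_transcendence_degree_bound: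
  assumes "infinite C" "|K| \<le>o |C|" "finite_transcendence_degree L K"
  shows "|carrier L| \<le>o |C|"
proof -
  obtain B where B: "finite B" "transcendence_basis L K B"
    using assms(3) by (auto simp: finite_transcendence_degree_def)
  have Bc: "K \<union> B \<subseteq> carrier L"
    using B(2) base_carrier by (auto simp: transcendence_basis_def algebraically_independent_def)
  have "|K \<union> B| \<le>o |C|"
    using assms(1,2) finite_ordLeq_infinite[OF B(1)] by (intro card_of_Un_infinite_bound) auto
  then show ?thesis
    using B(2) card_of_algebraic_bound[OF assms(1) generate_field_is_subfield[OF Bc]
        card_of_generate_field_bound[OF assms(1)]] by (simp add: transcendence_basis_def)
qed

section \<open>Linearly independent families in a transcendental extension\<close>

context
  fixes x assumes x: "x \<in> carrier L" and transc: "transcendental K x"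
begin

lemma eval_transcendental_inj:
  "p \<in> carrier (K[X]) \<Longrightarrow> r \<in> carrier (K[X]) \<Longrightarrow> eval p x = eval r x \<Longrightarrow> p = r"
  using transc unfolding transcendental_def inj_on_def by blast

lemma monom_in_univ_poly: "c \<in> K \<Longrightarrow> c \<noteq> \<zero> \<Longrightarrow> monom c n \<in> carrier (K[X])"
  by (auto simp: univ_poly_def polynomial_def monom_def)

text \<open>A dependence writes a power of \<open>x\<close> as the value of a polynomial whose
  coefficient in that degree is zero. Injectivity of evaluation then identifies this polynomial with
  the monomial itself, a contradiction.\<close>

lemma powers_lin_indep: "lin_indep (range (\<lambda>i::nat. x [^] i))"
  and powers_inj: "inj (\<lambda>i::nat. x [^] i)"
proof -
  have one: "\<one> \<in> K" "\<one> \<noteq> \<zero>" using base_closed(2) by auto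
  have ev1: "eval (monom \<one> i) x = x [^] i" for i
    using eval_monom[OF one_closed x] x by simp
  have co: "coeff (monom c i) k = (if k = i then c else \<zero>)" if "c \<in> K" for c i k
    using monom_coeff[of c i] that by auto
  show "inj (\<lambda>i::nat. x [^] i)"
  proof (rule injI)
    fix i j :: nat assume "x [^] i = x [^] j"
    then have "monom \<one> i = monom \<one> j"
      by (intro eval_transcendental_inj monom_in_univ_poly one) (simp add: ev1)
    then show "i = j" by (simp add: monom_def)
  qed
  show "lin_indep (range (\<lambda>i::nat. x [^] i))"
    unfolding lin_indep_def
  proof (intro conjI ballI notI)
    show "range (\<lambda>i::nat. x [^] i) \<subseteq> carrier L" using x by auto
    fix s assume "s \<in> range (\<lambda>i::nat. x [^] i)" and sp: "s \<in> spn (range (\<lambda>i::nat. x [^] i) - {s})"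
    then obtain i :: nat where s: "s = x [^] i" by blast
    have "\<exists>p\<in>carrier (K[X]). v = eval p x \<and> coeff p i = \<zero>"
      if "v \<in> spn (range (\<lambda>i::nat. x [^] i) - {x [^] i})" for v
      using that
    proof induction
      case zero
      have "[] \<in> carrier (K[X])" by (simp add: univ_poly_def polynomial_def)
      then show ?case by force
    next
      case (step v c t)
      then obtain p where p: "p \<in> carrier (K[X])" "v = eval p x" "coeff p i = \<zero>" by blast
      obtain j where t: "t = x [^] (j::nat)" "j \<noteq> i" using step by auto
      show ?case
      \<comment> \<open>The list \<open>monom \<zero> j\<close> is not a normalised polynomial, so
        the zero coefficient is treated apart.\<close>
      proof (cases "c = \<zero>")
        case True
        have "v \<in> carrier L" using p x eval_poly_in_carrier[OF base_subring]
          by (simp add: univ_poly_def)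
        then have "c \<otimes> t \<oplus> v = v" using True t x by simp
        then show ?thesis using p by auto
      next
        case False
        have m: "monom c j \<in> carrier (K[X])" using monom_in_univ_poly step False by blast
        have c: "set (monom c j) \<subseteq> carrier L" "set p \<subseteq> carrier L"
          using m p(1) base_carrier by (auto simp: univ_poly_def polynomial_def)
        interpret UP: ring "K[X]" by (rule univ_poly_is_ring[OF base_subring])
        have "monom c j \<oplus>\<^bsub>K[X]\<^esub> p \<in> carrier (K[X])" using m p(1) by simp
        moreover have "eval (monom c j \<oplus>\<^bsub>K[X]\<^esub> p) x = c \<otimes> t \<oplus> v"
          using eval_poly_add[OF c x] eval_monom[of c x j] step x p t by (simp add: univ_poly_add)
        moreover have "coeff (monom c j \<oplus>\<^bsub>K[X]\<^esub> p) i = \<zero>"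
          using poly_add_coeff[OF c] p(3) co[OF step(2)] t(2) by (simp add: univ_poly_add)
        ultimately show ?thesis by metis
      qed
    qed
    then obtain p where p: "p \<in> carrier (K[X])" "x [^] i = eval p x" "coeff p i = \<zero>"
      using sp s by blast
    then have "p = monom \<one> i"
      by (intro eval_transcendental_inj monom_in_univ_poly one) (simp_all add: ev1)
    then show False using p(3) co[OF one(1)] one by simp
  qed
qed

lemma minus_base_nonzero: "a \<in> K \<Longrightarrow> x \<ominus> a \<noteq> \<zero>"
proof
  assume a: "a \<in> K" and "x \<ominus> a = \<zero>"
  then have "x = a" using x by (simp add: r_right_minus_eq)
  then have "algebraic K x" using algebraic_self[OF base_subring a] by (simp add: over_def)
  then show False using transc by simp
qed

text \<open>Pole argument: a combination of the elements \<open>inv (x \<ominus> a)\<close> with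
  \<open>a \<noteq> b\<close> has a denominator that does not vanish at \<open>b\<close>, whereas
  \<open>inv (x \<ominus> b)\<close> has a pole there.\<close>

lemma inverses_lin_indep: "lin_indep ((\<lambda>a. inv (x \<ominus> a)) ` K)"
  and inverses_inj: "inj_on (\<lambda>a. inv (x \<ominus> a)) K"
proof -
  have U: "x \<ominus> a \<in> Units L" if "a \<in> K" for a
    using minus_base_nonzero[OF that] that x field_Units by auto
  show inj: "inj_on (\<lambda>a. inv (x \<ominus> a)) K"
  proof (rule inj_onI)
    fix a b assume ab: "a \<in> K" "b \<in> K" "inv (x \<ominus> a) = inv (x \<ominus> b)"
    then have "x \<ominus> a = x \<ominus> b" using U Units_inv_inv by metis
    moreover have "a = x \<ominus> (x \<ominus> a)" "b = x \<ominus> (x \<ominus> b)"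
      using base_in_carrier[OF ab(1)] base_in_carrier[OF ab(2)] x by algebra+
    ultimately show "a = b" by simp
  qed
  show "lin_indep ((\<lambda>a. inv (x \<ominus> a)) ` K)"
    unfolding lin_indep_def
  proof (intro conjI ballI notI)
    show "(\<lambda>a. inv (x \<ominus> a)) ` K \<subseteq> carrier L" using U by auto
    fix s assume "s \<in> (\<lambda>a. inv (x \<ominus> a)) ` K" and sp: "s \<in> spn ((\<lambda>a. inv (x \<ominus> a)) ` K - {s})"
    then obtain b where b: "b \<in> K" "s = inv (x \<ominus> b)" by blast
    have bc: "b \<in> carrier L" using b by blast
    interpret X: ring_hom_ring "K[X]" L "\<lambda>p. eval p x" by (rule eval_ring_hom[OF base_subring x])
    interpret B: ring_hom_ring "K[X]" L "\<lambda>p. eval p b" by (rule eval_ring_hom[OF base_subring bc])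
    have lin: "[\<one>, \<ominus> a] \<in> carrier (K[X])" "\<And>y. y \<in> carrier L \<Longrightarrow> eval [\<one>, \<ominus> a] y = y \<ominus> a"
      if "a \<in> K" for a
      using that by (auto simp: univ_poly_def polynomial_def a_minus_def)
    have const: "\<exists>k\<in>carrier (K[X]). \<forall>y\<in>carrier L. eval k y = c" if "c \<in> K" for c
    proof (cases "c = \<zero>")
      case True
      then show ?thesis by (intro bexI[of _ "[]"]) (auto simp: univ_poly_def polynomial_def)
    next
      case False
      then show ?thesis using that by (intro bexI[of _ "[c]"]) (auto simp: univ_poly_def polynomial_def)
    qed
    \<comment> \<open>That \<open>v\<close> is a fraction in \<open>x\<close> regular at
      \<open>b\<close> is expressed by cross-multiplication: \<open>p\<close> is a numerator and
      \<open>r\<close> a denominator.\<close>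
    have "\<exists>p\<in>carrier (K[X]). \<exists>r\<in>carrier (K[X]). v \<otimes> eval r x = eval p x \<and> eval r b \<noteq> \<zero>"
      if "v \<in> spn ((\<lambda>a. inv (x \<ominus> a)) ` K - {inv (x \<ominus> b)})" for v
      using that
    proof induction
      case zero
      have "[] \<in> carrier (K[X])" "[\<one>] \<in> carrier (K[X])" by (auto simp: univ_poly_def polynomial_def)
      then show ?case using x bc by (intro bexI[of _ "[]"] bexI[of _ "[\<one>]"]) auto
    next
      case (step v c t)
      have "(\<lambda>a. inv (x \<ominus> a)) ` K - {inv (x \<ominus> b)} \<subseteq> carrier L" using U by auto
      then have vc: "v \<in> carrier L" using spn_carrier step(1) by blast
      obtain p r where p: "p \<in> carrier (K[X])" and r: "r \<in> carrier (K[X])"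
        and pr: "v \<otimes> eval r x = eval p x" "eval r b \<noteq> \<zero>" using step by blast
      obtain a where a: "a \<in> K" "t = inv (x \<ominus> a)" "a \<noteq> b" using step by auto
      obtain k where k: "k \<in> carrier (K[X])" "\<And>y. y \<in> carrier L \<Longrightarrow> eval k y = c"
        using const[OF step(2)] by blast
      have ac: "a \<in> carrier L" "c \<in> carrier L" "t \<in> carrier L" and tx: "t \<otimes> (x \<ominus> a) = \<one>"
        using a U step(2) by auto
      let ?l = "[\<one>, \<ominus> a]"
      have ev: "eval r x \<in> carrier L" "eval p x \<in> carrier L" "eval r b \<in> carrier L"
        using r p by auto
      \<comment> \<open>Adding \<open>c \<otimes> t\<close> multiplies the denominator by the linear
        polynomial \<open>?l\<close>, whose value at \<open>b\<close> is
        \<open>b \<ominus> a\<close>, hence nonzero. The constant polynomial \<open>k\<close>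
        carries the coefficient \<open>c\<close> into the new numerator.\<close>
      have "(c \<otimes> t \<oplus> v) \<otimes> eval (r \<otimes>\<^bsub>K[X]\<^esub> ?l) x = (c \<otimes> t \<oplus> v) \<otimes> (eval r x \<otimes> (x \<ominus> a))"
        using X.hom_mult[OF r lin(1)[OF a(1)]] lin(2)[OF a(1) x] by simp
      also have "\<dots> = c \<otimes> (t \<otimes> (x \<ominus> a)) \<otimes> eval r x \<oplus> (v \<otimes> eval r x) \<otimes> (x \<ominus> a)"
        using ac ev x vc by algebra
      also have "\<dots> = c \<otimes> eval r x \<oplus> eval p x \<otimes> (x \<ominus> a)"
        unfolding tx pr using ac by simp
      also have "\<dots> = eval (k \<otimes>\<^bsub>K[X]\<^esub> r \<oplus>\<^bsub>K[X]\<^esub> p \<otimes>\<^bsub>K[X]\<^esub> ?l) x"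
        using X.hom_mult[OF k(1) r] X.hom_mult[OF p lin(1)[OF a(1)]] lin[OF a(1)] k x r p
          X.hom_add[of "k \<otimes>\<^bsub>K[X]\<^esub> r" "p \<otimes>\<^bsub>K[X]\<^esub> ?l"] by simp
      finally have 1: "(c \<otimes> t \<oplus> v) \<otimes> eval (r \<otimes>\<^bsub>K[X]\<^esub> ?l) x =
        eval (k \<otimes>\<^bsub>K[X]\<^esub> r \<oplus>\<^bsub>K[X]\<^esub> p \<otimes>\<^bsub>K[X]\<^esub> ?l) x" .
      have "eval (r \<otimes>\<^bsub>K[X]\<^esub> ?l) b = eval r b \<otimes> (b \<ominus> a)"
        using B.hom_mult[OF r lin(1)[OF a(1)]] lin(2)[OF a(1) bc] by simp
      also have "\<dots> \<noteq> \<zero>"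
        using pr(2) ev(3) a(3) ac bc by (simp add: integral_iff r_right_minus_eq)
      finally have 2: "eval (r \<otimes>\<^bsub>K[X]\<^esub> ?l) b \<noteq> \<zero>" .
      have 3: "r \<otimes>\<^bsub>K[X]\<^esub> ?l \<in> carrier (K[X])" "k \<otimes>\<^bsub>K[X]\<^esub> r \<oplus>\<^bsub>K[X]\<^esub> p \<otimes>\<^bsub>K[X]\<^esub> ?l \<in> carrier (K[X])"
        using r k p lin(1)[OF a(1)] by auto
      show ?case by (rule bexI[OF _ 3(2)], rule bexI[OF _ 3(1)]) (use 1 2 in blast)
    qed
    then obtain p r where p: "p \<in> carrier (K[X])" and r: "r \<in> carrier (K[X])"
      and pr: "inv (x \<ominus> b) \<otimes> eval r x = eval p x" "eval r b \<noteq> \<zero>" using sp b(2) by blast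
    have ev: "eval r x \<in> carrier L" "eval p x \<in> carrier L" "eval p b \<in> carrier L" using r p by auto
    have "eval r x = (inv (x \<ominus> b) \<otimes> eval r x) \<otimes> (x \<ominus> b)"
      using U[OF b(1)] ev Units_l_inv[OF U[OF b(1)]] Units_inv_closed[OF U[OF b(1)]]
      by (metis Units_closed m_assoc m_comm r_one)
    also have "\<dots> = eval (p \<otimes>\<^bsub>K[X]\<^esub> [\<one>, \<ominus> b]) x"
      unfolding pr(1) using X.hom_mult[OF p lin(1)[OF b(1)]] lin(2)[OF b(1) x] by simp
    \<comment> \<open>By transcendence the identity at \<open>x\<close> is one of polynomials, so it
      may be evaluated at \<open>b\<close>. There the factor \<open>b \<ominus> b\<close> makes the
      denominator vanish.\<close>
    finally have "r = p \<otimes>\<^bsub>K[X]\<^esub> [\<one>, \<ominus> b]"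
      using eval_transcendental_inj[OF r] p lin(1)[OF b(1)] by auto
    then have "eval r b = eval p b \<otimes> (b \<ominus> b)"
      using B.hom_mult[OF p lin(1)[OF b(1)]] lin(2)[OF b(1) bc] by simp
    then show False using pr(2) ev(3) bc by (simp add: a_minus_def r_neg)
  qed
qed

end

end

section \<open>Automorphisms\<close>

context field_ext
begin

lemma Aut_carrier_iff:
  "f \<in> carrier (Aut_ext L K) \<longleftrightarrow> f \<in> Bij (carrier L) \<and> f \<in> ring_hom L L \<and> (\<forall>k\<in>K. f k = k)"
  by (simp add: Aut_ext_def)

lemma Aut_mult:
  "f \<in> carrier (Aut_ext L K) \<Longrightarrow> g \<in> carrier (Aut_ext L K) \<Longrightarrow> v \<in> carrier L \<Longrightarrow>
    (f \<otimes>\<^bsub>Aut_ext L K\<^esub> g) v = f (g v)"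
  by (auto simp: Aut_ext_def BijGroup_def compose_def)

lemma Aut_in_GL: "f \<in> carrier (Aut_ext L K) \<Longrightarrow> f \<in> carrier (GL_ext L K)"
  unfolding Aut_carrier_iff GL_carrier_iff K_linear_def
  by (auto simp: ring_hom_add ring_hom_mult ring_hom_closed)

lemma subgroup_Aut: "subgroup (carrier (Aut_ext L K)) (BijGroup (carrier L))"
proof (rule group.subgroupI[OF group_BijGroup])
  show "carrier (Aut_ext L K) \<subseteq> carrier (BijGroup (carrier L))"
    by (auto simp: Aut_ext_def BijGroup_def)
  have "(\<lambda>x\<in>carrier L. x) \<in> ring_hom L L" by (auto intro!: ring_hom_memI)
  then have "(\<lambda>x\<in>carrier L. x) \<in> carrier (Aut_ext L K)"
    unfolding Aut_carrier_iff using id_Bij by auto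
  then show "carrier (Aut_ext L K) \<noteq> {}" by blast
  fix f assume "f \<in> carrier (Aut_ext L K)"
  then have f: "f \<in> Bij (carrier L)" "f \<in> ring_hom L L" "\<And>k. k \<in> K \<Longrightarrow> f k = k"
    by (auto simp: Aut_carrier_iff)
  let ?g = "inv_into (carrier L) f"
  have bij: "inj_on f (carrier L)" "f ` carrier L = carrier L"
    using f by (auto simp: Bij_def bij_betw_def)
  have g: "?g v \<in> carrier L" "f (?g v) = v" if "v \<in> carrier L" for v
    using that bij by (auto simp: inv_into_into f_inv_into_f)
  have eq: "?g w = v" if "v \<in> carrier L" "f v = w" for v w
    using that bij by auto
  have "restrict ?g (carrier L) \<in> ring_hom L L"
  proof (rule ring_hom_memI)
    fix v w assume v: "v \<in> carrier L" and w: "w \<in> carrier L"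
    have "?g (v \<otimes> w) = ?g v \<otimes> ?g w" "?g (v \<oplus> w) = ?g v \<oplus> ?g w"
      using g v w ring_hom_mult[OF f(2)] ring_hom_add[OF f(2)] by (auto intro!: eq)
    then show "restrict ?g (carrier L) (v \<otimes> w) = restrict ?g (carrier L) v \<otimes> restrict ?g (carrier L) w"
      "restrict ?g (carrier L) (v \<oplus> w) = restrict ?g (carrier L) v \<oplus> restrict ?g (carrier L) w"
      using v w by simp_all
  next
    have "?g \<one> = \<one>" using ring_hom_one[OF f(2)] by (intro eq) auto
    then show "restrict ?g (carrier L) \<one> = \<one>" by simp
  qed (use g in auto)
  moreover have "restrict ?g (carrier L) k = k" if "k \<in> K" for k
    using that f(3) eq[of k k] by auto
  ultimately show "inv\<^bsub>BijGroup (carrier L)\<^esub> f \<in> carrier (Aut_ext L K)"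
    unfolding inv_BijGroup[OF f(1)] Aut_carrier_iff using restrict_inv_into_Bij[OF f(1)] by blast
  fix h assume "h \<in> carrier (Aut_ext L K)"
  then have h: "h \<in> Bij (carrier L)" "h \<in> ring_hom L L" "\<And>k. k \<in> K \<Longrightarrow> h k = k"
    by (auto simp: Aut_carrier_iff)
  have "compose (carrier L) f h \<in> ring_hom L L"
    using f(2) h(2) by (auto simp: compose_def ring_hom_def Pi_iff)
  then show "f \<otimes>\<^bsub>BijGroup (carrier L)\<^esub> h \<in> carrier (Aut_ext L K)"
    unfolding Aut_carrier_iff using compose_Bij[OF f(1) h(1)] f h
    by (auto simp: BijGroup_def compose_def)
qed

lemma group_Aut: "group (Aut_ext L K)"
proof -
  have "Aut_ext L K = BijGroup (carrier L) \<lparr>carrier := carrier (Aut_ext L K)\<rparr>"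
    by (simp add: Aut_ext_def)
  then show ?thesis
    using group.subgroup_imp_group[OF group_BijGroup subgroup_Aut] by simp
qed

lemma Aut_closed: "f \<in> carrier (Aut_ext L K) \<Longrightarrow> v \<in> carrier L \<Longrightarrow> f v \<in> carrier L"
  using Bij_imp_funcset by (auto simp: Aut_carrier_iff)

lemma Aut_one: "v \<in> carrier L \<Longrightarrow> \<one>\<^bsub>Aut_ext L K\<^esub> v = v"
  by (simp add: Aut_ext_def BijGroup_def)

lemma Aut_inv:
  assumes "f \<in> carrier (Aut_ext L K)" "v \<in> carrier L"
  shows "f ((inv\<^bsub>Aut_ext L K\<^esub> f) v) = v" "(inv\<^bsub>Aut_ext L K\<^esub> f) (f v) = v"
proof -
  interpret A: group "Aut_ext L K" by (rule group_Aut)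
  have i: "inv\<^bsub>Aut_ext L K\<^esub> f \<in> carrier (Aut_ext L K)" using assms by simp
  show "f ((inv\<^bsub>Aut_ext L K\<^esub> f) v) = v" "(inv\<^bsub>Aut_ext L K\<^esub> f) (f v) = v"
    using Aut_mult[OF assms(1) i assms(2)] Aut_mult[OF i assms] A.r_inv[OF assms(1)]
      A.l_inv[OF assms(1)] Aut_one[OF assms(2)] by simp_all
qed

context
  fixes f assumes f: "f \<in> carrier (Aut_ext L K)"
begin

lemma Aut_ring_hom_cring: "ring_hom_cring L L f"
  using f by unfold_locales (auto simp: Aut_carrier_iff)

lemma Aut_inj: "inj_on f (carrier L)"
  using f by (auto simp: Aut_carrier_iff Bij_def bij_betw_def)

lemma Aut_fixes_base: "k \<in> K \<Longrightarrow> f k = k"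
  using f by (auto simp: Aut_carrier_iff)

text \<open>A relation among the elements \<open>f b\<close> is pulled back by renaming variables.
  As \<open>f\<close> fixes the coefficients, it maps the value of the pulled-back polynomial to
  that of the original one, and \<open>f\<close> is injective.\<close>

lemma algebraically_independent_image:
  assumes "algebraically_independent L K B"
  shows "algebraically_independent L K (f ` B)"
proof -
  interpret H: ring_hom_cring L L f by (rule Aut_ring_hom_cring)
  have B: "B \<subseteq> carrier L" and indep: "\<And>P. P \<in> indexed_pset B K \<Longrightarrow>
      indexed_poly_eval L P = \<zero> \<Longrightarrow> P = indexed_const \<zero>"
    using assms by (auto simp: algebraically_independent_def)
  have injB: "inj_on f B" using inj_on_subset[OF Aut_inj B] .
  have "P = indexed_const \<zero>" if P: "P \<in> indexed_pset (f ` B) K" "indexed_poly_eval L P = \<zero>" for P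
  proof -
    have P1: "finite {m. P m \<noteq> \<zero>}" and P2: "\<And>m. P m \<in> K"
      and P3: "\<And>m. P m \<noteq> \<zero> \<Longrightarrow> set_mset m \<subseteq> f ` B"
      using P(1) unfolding indexed_pset_iff by auto
    \<comment> \<open>Outside monomials in \<open>B\<close> the value is set to zero:
      \<open>f\<close> is known to be injective only on \<open>carrier L\<close>, and
      \<open>Q\<close> must have its support in the monomials over \<open>B\<close>.\<close>
    define Q where "Q m = (if set_mset m \<subseteq> B then P (image_mset f m) else \<zero>)" for m
    let ?S = "{m. Q m \<noteq> \<zero>}"
    have SB: "set_mset m \<subseteq> B" if "m \<in> ?S" for m using that by (auto simp: Q_def split: if_splits)
    have inv_l: "image_mset (inv_into B f) (image_mset f m) = m" if "set_mset m \<subseteq> B" for m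
    proof -
      have "image_mset (\<lambda>b. inv_into B f (f b)) m = image_mset (\<lambda>b. b) m"
        using that injB by (intro image_mset_cong) auto
      then show ?thesis by (simp add: multiset.map_comp comp_def)
    qed
    have inv_r: "image_mset f (image_mset (inv_into B f) m) = m" "set_mset (image_mset (inv_into B f) m) \<subseteq> B"
      if "set_mset m \<subseteq> f ` B" for m
    proof -
      have "image_mset (\<lambda>c. f (inv_into B f c)) m = image_mset (\<lambda>c. c) m"
        using that by (intro image_mset_cong) (auto simp: f_inv_into_f)
      then show "image_mset f (image_mset (inv_into B f) m) = m"
        by (simp add: multiset.map_comp comp_def)
      show "set_mset (image_mset (inv_into B f) m) \<subseteq> B" using that by (auto simp: subset_iff intro: inv_into_into)
    qed
    have injS: "inj_on (image_mset f) ?S"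
      using inv_l SB by (intro inj_on_inverseI[where g = "image_mset (inv_into B f)"]) auto
    have imS: "image_mset f ` ?S = {m. P m \<noteq> \<zero>}"
    proof
      show "image_mset f ` ?S \<subseteq> {m. P m \<noteq> \<zero>}" by (auto simp: Q_def split: if_splits)
      show "{m. P m \<noteq> \<zero>} \<subseteq> image_mset f ` ?S"
      proof
        fix m assume "m \<in> {m. P m \<noteq> \<zero>}"
        then have m: "P m \<noteq> \<zero>" "set_mset m \<subseteq> f ` B" using P3 by auto
        then have "image_mset (inv_into B f) m \<in> ?S" using inv_r[OF m(2)] by (simp add: Q_def)
        then show "m \<in> image_mset f ` ?S" using inv_r(1)[OF m(2)] by (metis imageI)
      qed
    qed
    have "finite ?S" using P1 imS injS finite_imageD by metis
    moreover have "range Q \<subseteq> K" using P2 base_closed(1) by (auto simp: Q_def)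
    ultimately have "Q \<in> indexed_pset B K"
      unfolding indexed_pset_iff using SB by blast
    moreover have "indexed_poly_eval L Q = \<zero>"
    proof -
      let ?t = "\<lambda>P m. P m \<otimes> (\<Otimes>b \<in> set_mset m. b [^] count m b)"
      have mc: "(\<lambda>b. b [^] count m b) \<in> set_mset m \<rightarrow> carrier L" if "set_mset m \<subseteq> carrier L" for m :: "'a multiset"
        using that by auto
      have tQ: "?t Q m \<in> carrier L" and tP: "f (?t Q m) = ?t P (image_mset f m)" if m: "m \<in> ?S" for m
      proof -
        have mB: "set_mset m \<subseteq> B" "Q m = P (image_mset f m)" using SB[OF m] by (simp_all add: Q_def)
        have QK: "Q m \<in> K" using mB P2 by simp
        have cm: "(\<Otimes>b \<in> set_mset m. b [^] count m b) \<in> carrier L"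
          using mc mB(1) B by (intro finprod_closed) blast
        then show "?t Q m \<in> carrier L" using QK by blast
        have inj: "inj_on f (set_mset m)" using inj_on_subset[OF injB mB(1)] .
        have mcar: "b \<in> carrier L" if "b \<in># m" for b using that mB(1) B by blast
        \<comment> \<open>Injectivity on the variables of \<open>m\<close> prevents exponents from
          being merged by the renaming.\<close>
        have cnt: "count (image_mset f m) (f b) = count m b" if "b \<in># m" for b
        proof -
          have "f -` {f b} \<inter> set_mset m = {b}" using inj that by (auto simp: inj_on_def)
          then show ?thesis by (simp add: count_image_mset)
        qed
        have "f (\<Otimes>b \<in> set_mset m. b [^] count m b) = (\<Otimes>b \<in> set_mset m. f (b [^] count m b))"
          using H.hom_finprod[OF mc[of m]] mB(1) B by (simp add: comp_def)
        also have "\<dots> = (\<Otimes>b \<in> set_mset m. f b [^] count (image_mset f m) (f b))"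
          using mcar cnt H.ring.hom_nat_pow by (intro finprod_cong') auto
        also have "\<dots> = (\<Otimes>c \<in> set_mset (image_mset f m). c [^] count (image_mset f m) c)"
          unfolding set_image_mset using inj mcar by (intro finprod_reindex[symmetric]) auto
        finally show "f (?t Q m) = ?t P (image_mset f m)"
          using H.hom_mult[OF base_in_carrier[OF QK] cm] Aut_fixes_base[OF QK] mB(2) by simp
      qed
      have tPc: "?t P (image_mset f m) \<in> carrier L" if "m \<in> ?S" for m
        using H.hom_closed[OF tQ[OF that]] tP[OF that] by simp
      have tQPi: "?t Q \<in> ?S \<rightarrow> carrier L" by (rule Pi_I) (rule tQ)
      have "f (indexed_poly_eval L Q) = (\<Oplus>m \<in> ?S. f (?t Q m))"
        using H.hom_finsum[OF tQPi] unfolding indexed_poly_eval_def comp_def .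
      also have "\<dots> = (\<Oplus>m \<in> ?S. ?t P (image_mset f m))"
        by (intro add.finprod_cong' refl tP Pi_I tPc)
      also have "\<dots> = (\<Oplus>m \<in> image_mset f ` ?S. ?t P m)"
        by (rule add.finprod_reindex[symmetric, OF _ injS]) (use tPc in blast)
      also have "\<dots> = \<zero>" using P(2) unfolding imS indexed_poly_eval_def .
      finally have "f (indexed_poly_eval L Q) = f \<zero>" by simp
      moreover have "indexed_poly_eval L Q \<in> carrier L"
        unfolding indexed_poly_eval_def by (rule finsum_closed[OF tQPi])
      ultimately show ?thesis using inj_onD[OF Aut_inj] zero_closed by metis
    qed
    ultimately have "Q = indexed_const \<zero>" using indep by blast
    then have "?S = {}" by (simp add: indexed_const_def)
    then have "{m. P m \<noteq> \<zero>} = {}" using imS by simp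
    then show ?thesis by (auto simp: indexed_const_def)
  qed
  then show ?thesis
    using B by (auto simp: algebraically_independent_def)
qed

lemma Aut_m_inv: "h \<in> carrier L \<Longrightarrow> h \<noteq> \<zero> \<Longrightarrow> f (inv h) = inv (f h)"
proof -
  interpret H: ring_hom_cring L L f by (rule Aut_ring_hom_cring)
  assume h: "h \<in> carrier L" "h \<noteq> \<zero>"
  then have U: "h \<in> Units L" using field_Units by blast
  have "f h \<otimes> f (inv h) = f (h \<otimes> inv h)" using U by (intro H.hom_mult[symmetric]) auto
  then have "f h \<otimes> f (inv h) = \<one>" using U by simp
  then show ?thesis using comm_inv_char[of "f h" "f (inv h)"] U h by simp
qed

lemma generate_field_image_subset:
  assumes "H \<subseteq> carrier L"
  shows "f ` generate_field L H \<subseteq> generate_field L (f ` H)"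
proof
  interpret H: ring_hom_cring L L f by (rule Aut_ring_hom_cring)
  fix y assume "y \<in> f ` generate_field L H"
  then obtain h where h: "h \<in> generate_field L H" "y = f h" by blast
  have "f h \<in> generate_field L (f ` H)" using h(1)
  proof induction
    case one
    then show ?case using generate_field.one[of L "f ` H"] by simp
  next
    case (incl h)
    then show ?case by (auto intro: generate_field.incl)
  next
    case (a_inv h)
    then show ?case using generate_field.a_inv generate_field_in_carrier[OF assms] by fastforce
  next
    case (m_inv h)
    have hc: "h \<in> carrier L" using m_inv generate_field_in_carrier[OF assms] by blast
    have "f h \<noteq> \<zero>" using inj_onD[OF Aut_inj, of h \<zero>] hc m_inv by auto
    then show ?case using generate_field.m_inv[OF m_inv.IH] Aut_m_inv[OF hc] m_inv by simp
  next
    case (eng_add g h)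
    then show ?case using generate_field.eng_add[OF eng_add.IH] generate_field_in_carrier[OF assms] by simp
  next
    case (eng_mult g h)
    then show ?case using generate_field.eng_mult[OF eng_mult.IH] generate_field_in_carrier[OF assms] by simp
  qed
  then show "y \<in> generate_field L (f ` H)" using h by simp
qed

text \<open>Applying \<open>f\<close> to the coefficients of a polynomial with root \<open>x\<close>
  gives one with root \<open>f x\<close>. Injectivity keeps the leading coefficient nonzero, so the
  new list is still normalised.\<close>

lemma algebraic_over_image:
  assumes "subring F L" "algebraic_over L F"
  shows "algebraic_over L (f ` F)"
  unfolding algebraic_over_def
proof
  interpret H: ring_hom_cring L L f by (rule Aut_ring_hom_cring)
  fix y assume y: "y \<in> carrier L"
  have Fc: "F \<subseteq> carrier L" using subringE(1)[OF assms(1)] .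
  obtain x where x: "x \<in> carrier L" "y = f x"
    using f y by (auto simp: Aut_carrier_iff Bij_def bij_betw_def)
  have "(algebraic over F) x" using assms(2) x by (simp add: algebraic_over_def over_def)
  then obtain p where p: "p \<in> carrier (F[X])" "p \<noteq> []" "eval p x = \<zero>"
    using algebraicE[OF assms(1) x(1)] by blast
  have pF: "set p \<subseteq> F" "hd p \<noteq> \<zero>" using p by (auto simp: univ_poly_def polynomial_def)
  have "hd p \<in> carrier L" using hd_in_set[OF p(2)] pF(1) Fc by blast
  then have "f (hd p) \<noteq> \<zero>"
    using inj_onD[OF Aut_inj, of "hd p" \<zero>] pF p(2) Fc by auto
  then have "map f p \<in> carrier ((f ` F)[X])"
    using pF p(2) by (auto simp: univ_poly_def polynomial_def hd_map)
  moreover have "eval (map f p) y = \<zero>"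
    using H.ring.eval_hom'[OF x(1), of p] pF(1) Fc p(3) x(2) by auto
  ultimately show "algebraic (f ` F) y"
    using algebraicI[of "map f p" "f ` F" y] p(2) by (simp add: over_def)
qed

end

text \<open>The second inclusion is the first one applied to the inverse automorphism.\<close>

lemma generate_field_image:
  assumes f: "f \<in> carrier (Aut_ext L K)" and H: "H \<subseteq> carrier L"
  shows "f ` generate_field L H = generate_field L (f ` H)"
proof
  interpret A: group "Aut_ext L K" by (rule group_Aut)
  let ?g = "inv\<^bsub>Aut_ext L K\<^esub> f"
  have g: "?g \<in> carrier (Aut_ext L K)" using f by simp
  show "f ` generate_field L H \<subseteq> generate_field L (f ` H)"
    by (rule generate_field_image_subset[OF f H])
  have fH: "f ` H \<subseteq> carrier L" using Aut_closed[OF f] H by blast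
  have "?g (f h) = h" if "h \<in> H" for h using Aut_inv(2)[OF f] H that by blast
  then have "?g ` f ` H = H" by (simp add: image_image)
  then have sub: "?g ` generate_field L (f ` H) \<subseteq> generate_field L H"
    using generate_field_image_subset[OF g fH] by simp
  show "generate_field L (f ` H) \<subseteq> f ` generate_field L H"
  proof
    fix y assume y: "y \<in> generate_field L (f ` H)"
    then have "f (?g y) = y" using Aut_inv(1)[OF f] generate_field_in_carrier[OF fH] by blast
    then show "y \<in> f ` generate_field L H" using sub y by (metis imageI subsetD)
  qed
qed

lemma purely_transcendental_image:
  assumes f: "f \<in> carrier (Aut_ext L K)" and "purely_transcendental L K F"
  shows "purely_transcendental L K (f ` F)"
proof -
  obtain B where B: "algebraically_independent L K B" "F = generate_field L (K \<union> B)"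
    using assms(2) by (auto simp: purely_transcendental_def)
  have c: "K \<union> B \<subseteq> carrier L" using B base_carrier by (auto simp: algebraically_independent_def)
  have "f ` K = K" using Aut_fixes_base[OF f] by force
  then have "f ` F = generate_field L (K \<union> f ` B)"
    using generate_field_image[OF f c] B(2) by (simp add: image_Un)
  then show ?thesis
    using algebraically_independent_image[OF f B(1)] by (auto simp: purely_transcendental_def)
qed

end

section \<open>Conjugate subgroups\<close>

context group
begin

lemma conjugate_by_eq:
  "conjugate_by G x H = (\<lambda>h. inv x \<otimes> h \<otimes> x) ` H"
  by (auto simp: conjugate_by_def l_coset_def r_coset_def)

lemma conjugate_by_one: "H \<subseteq> carrier G \<Longrightarrow> conjugate_by G \<one> H = H"
  unfolding conjugate_by_eq by (simp add: subset_iff)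

lemma subgroup_conjugate_by:
  assumes x: "x \<in> carrier G" and H: "subgroup H G"
  shows "subgroup (conjugate_by G x H) G"
proof -
  have Hc: "h \<in> carrier G" if "h \<in> H" for h using subgroup.mem_carrier[OF H that] .
  show ?thesis
    unfolding conjugate_by_eq
  proof (rule subgroupI)
    show "(\<lambda>h. inv x \<otimes> h \<otimes> x) ` H \<subseteq> carrier G" using x Hc by auto
    show "(\<lambda>h. inv x \<otimes> h \<otimes> x) ` H \<noteq> {}" using subgroup.one_closed[OF H] by blast
  next
    fix a assume "a \<in> (\<lambda>h. inv x \<otimes> h \<otimes> x) ` H"
    then obtain h where h: "h \<in> H" "a = inv x \<otimes> h \<otimes> x" by blast
    then have "inv a = inv x \<otimes> inv h \<otimes> x"
      using x Hc by (simp add: inv_mult_group m_assoc)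
    then show "inv a \<in> (\<lambda>h. inv x \<otimes> h \<otimes> x) ` H" using subgroup.m_inv_closed[OF H h(1)] by blast
    fix b assume "b \<in> (\<lambda>h. inv x \<otimes> h \<otimes> x) ` H"
    then obtain k where k: "k \<in> H" "b = inv x \<otimes> k \<otimes> x" by blast
    have "x \<otimes> (inv x \<otimes> (k \<otimes> x)) = k \<otimes> x"
      using x Hc[OF k(1)] by (simp add: m_assoc[symmetric])
    then have "a \<otimes> b = inv x \<otimes> (h \<otimes> k) \<otimes> x"
      using x Hc[OF h(1)] Hc[OF k(1)] h k by (simp add: m_assoc)
    then show "a \<otimes> b \<in> (\<lambda>h. inv x \<otimes> h \<otimes> x) ` H" using subgroup.m_closed[OF H h(1) k(1)] by blast
  qed
qed

text \<open>Makes conjugation of \<open>H\<close> constant on the right cosets of its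
  centralizer.\<close>

lemma conjugate_by_centralizer_mult:
  assumes z: "z \<in> centralizer G H" and x: "x \<in> carrier G" and H: "H \<subseteq> carrier G"
  shows "conjugate_by G (z \<otimes> x) H = conjugate_by G x H"
  unfolding conjugate_by_eq
proof (rule image_cong[OF refl])
  fix h assume h: "h \<in> H"
  have zc: "z \<in> carrier G" and zh: "z \<otimes> h = h \<otimes> z" using z h by (auto simp: centralizer_def)
  have hc: "h \<in> carrier G" using h H by blast
  have "inv (z \<otimes> x) \<otimes> h \<otimes> (z \<otimes> x) = inv x \<otimes> (inv z \<otimes> (h \<otimes> z)) \<otimes> x"
    using zc x hc by (simp add: inv_mult_group m_assoc)
  also have "inv z \<otimes> (h \<otimes> z) = h" unfolding zh[symmetric] using zc hc by (simp add: m_assoc[symmetric])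
  finally show "inv (z \<otimes> x) \<otimes> h \<otimes> (z \<otimes> x) = inv x \<otimes> h \<otimes> x" .
qed

lemma card_of_conjugates_le_index_centralizer:
  assumes H: "H \<subseteq> carrier G"
  shows "|{conjugate_by G x H | x. x \<in> carrier G}| \<le>o |rcosets (centralizer G H)|"
proof (rule surj_imp_ordLeq)
  \<comment> \<open>An arbitrary representative of each coset is chosen; by the previous lemma the
    conjugate does not depend on it, so every conjugate is reached.\<close>
  let ?f = "\<lambda>C. conjugate_by G (SOME x. x \<in> C) H"
  show "{conjugate_by G x H | x. x \<in> carrier G} \<subseteq> ?f ` (rcosets (centralizer G H))"
  proof
    fix P assume "P \<in> {conjugate_by G x H | x. x \<in> carrier G}"
    then obtain x where x: "x \<in> carrier G" "P = conjugate_by G x H" by blast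
    let ?C = "centralizer G H #> x"
    have "\<one> \<in> centralizer G H" using H by (auto simp: centralizer_def)
    then have "\<one> \<otimes> x \<in> ?C" unfolding r_coset_def by blast
    then have "(SOME y. y \<in> ?C) \<in> ?C" by (rule someI)
    then obtain z where "z \<in> centralizer G H" "(SOME y. y \<in> ?C) = z \<otimes> x"
      unfolding r_coset_def by blast
    then have "?f ?C = P" using conjugate_by_centralizer_mult[OF _ x(1) H] x(2) by simp
    moreover have "?C \<in> rcosets (centralizer G H)" using x(1) by (auto simp: RCOSETS_def)
    ultimately show "P \<in> ?f ` (rcosets (centralizer G H))" by blast
  qed
qed

end

section \<open>Noether solutions\<close>

context field_ext
begin

text \<open>The conjugate of \<open>g\<close> fixes \<open>x\<close> exactly when \<open>g\<close>
  fixes \<open>\<phi> x\<close>.\<close>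

lemma fixed_field_conjugate_by:
  assumes \<phi>: "\<phi> \<in> carrier (Aut_ext L K)" and G: "G \<subseteq> carrier (Aut_ext L K)"
  shows "fixed_field L (conjugate_by (Aut_ext L K) \<phi> G) = (inv\<^bsub>Aut_ext L K\<^esub> \<phi>) ` fixed_field L G"
proof -
  interpret A: group "Aut_ext L K" by (rule group_Aut)
  let ?\<psi> = "inv\<^bsub>Aut_ext L K\<^esub> \<phi>"
  have \<psi>: "?\<psi> \<in> carrier (Aut_ext L K)" using \<phi> by simp
  have ap: "(?\<psi> \<otimes>\<^bsub>Aut_ext L K\<^esub> g \<otimes>\<^bsub>Aut_ext L K\<^esub> \<phi>) v = ?\<psi> (g (\<phi> v))"
    if "g \<in> G" "v \<in> carrier L" for g v
  proof -
    have g: "g \<in> carrier (Aut_ext L K)" using that G by blast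
    show ?thesis
      using Aut_mult[OF A.m_closed[OF \<psi> g] \<phi> that(2)] Aut_mult[OF \<psi> g Aut_closed[OF \<phi> that(2)]] by simp
  qed
  have gc: "g v \<in> carrier L" if "g \<in> G" "v \<in> carrier L" for g v
    using that G Aut_closed by blast
  have "x \<in> fixed_field L (conjugate_by (Aut_ext L K) \<phi> G) \<longleftrightarrow> x \<in> ?\<psi> ` fixed_field L G" for x
  proof
    assume x: "x \<in> fixed_field L (conjugate_by (Aut_ext L K) \<phi> G)"
    then have xc: "x \<in> carrier L" by (simp add: fixed_field_def)
    have px: "\<phi> x \<in> carrier L" using Aut_closed[OF \<phi> xc] .
    have "g (\<phi> x) = \<phi> x" if g: "g \<in> G" for g
    proof -
      have "?\<psi> (g (\<phi> x)) = x"
        using x g ap[OF g xc] by (auto simp: fixed_field_def A.conjugate_by_eq)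
      then show ?thesis using Aut_inv(1)[OF \<phi> gc[OF g px]] by simp
    qed
    then have "\<phi> x \<in> fixed_field L G" using px by (simp add: fixed_field_def)
    then show "x \<in> ?\<psi> ` fixed_field L G" using Aut_inv(2)[OF \<phi> xc] by (metis imageI)
  next
    assume "x \<in> ?\<psi> ` fixed_field L G"
    then obtain y where y: "y \<in> carrier L" "\<And>g. g \<in> G \<Longrightarrow> g y = y" "x = ?\<psi> y"
      by (auto simp: fixed_field_def)
    have "x \<in> carrier L" using Aut_closed[OF \<psi> y(1)] y(3) by simp
    moreover have "\<phi> x = y" using Aut_inv(1)[OF \<phi> y(1)] y(3) by simp
    moreover have "?\<psi> (g y) = x" if "g \<in> G" for g using y(2)[OF that] y(3) by simp
    ultimately show "x \<in> fixed_field L (conjugate_by (Aut_ext L K) \<phi> G)"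
      using ap by (auto simp: fixed_field_def A.conjugate_by_eq)
  qed
  then show ?thesis by blast
qed

lemma noether_solution_fixed_subfield:
  assumes "noether_solution L K G"
  shows "subfield (fixed_field L G) L"
proof -
  obtain B where "algebraically_independent L K B" "fixed_field L G = generate_field L (K \<union> B)"
    using assms by (auto simp: noether_solution_def purely_transcendental_def)
  then show ?thesis
    using generate_field_is_subfield[of "K \<union> B"] base_carrier by (simp add: algebraically_independent_def)
qed

lemma noether_solution_conjugate_by:
  assumes G: "noether_solution L K G" and \<phi>: "\<phi> \<in> carrier (Aut_ext L K)"
  shows "noether_solution L K (conjugate_by (Aut_ext L K) \<phi> G)"
proof -
  interpret A: group "Aut_ext L K" by (rule group_Aut)
  have sub: "subgroup G (Aut_ext L K)" using G by (simp add: noether_solution_def)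
  have \<psi>: "inv\<^bsub>Aut_ext L K\<^esub> \<phi> \<in> carrier (Aut_ext L K)" using \<phi> by simp
  show ?thesis
    unfolding noether_solution_def fixed_field_conjugate_by[OF \<phi> subgroup.subset[OF sub]]
    using A.subgroup_conjugate_by[OF \<phi> sub] purely_transcendental_image[OF \<psi>]
      algebraic_over_image[OF \<psi> subfieldE(1)[OF noether_solution_fixed_subfield[OF G]]] G
    by (simp add: noether_solution_def)
qed

lemma Con_ext_eq:
  assumes "noether_solution L K G"
  shows "Con_ext L K G = {conjugate_by (Aut_ext L K) \<phi> G | \<phi>. \<phi> \<in> carrier (Aut_ext L K)}"
  using noether_solution_conjugate_by[OF assms] by (auto simp: Con_ext_def)

lemma con_ext_le_ind_ext:
  assumes "noether_solution L K G"
  shows "con_ext L K G \<le>o ind_ext L K G"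
proof -
  interpret A: group "Aut_ext L K" by (rule group_Aut)
  have "G \<subseteq> carrier (Aut_ext L K)"
    using assms subgroup.subset by (auto simp: noether_solution_def)
  then show ?thesis
    unfolding con_ext_def ind_ext_def Con_ext_eq[OF assms]
    by (rule A.card_of_conjugates_le_index_centralizer)
qed

section \<open>Noether solutions inside the derived group, and the class height group\<close>

lemma fixes_transcendental_in_derived:
  assumes L: "finite_transcendence_degree L K"
    and F: "subfield F L" "K \<subseteq> F" and x: "x \<in> F" "transcendental K x"
    and \<phi>: "\<phi> \<in> carrier (GL_ext L K)" "\<And>v. v \<in> F \<Longrightarrow> \<phi> v = v"
  shows "\<phi> \<in> derived (GL_ext L K) (carrier (GL_ext L K))"
proof -
  have sF: "subring F L" using subfieldE(1)[OF F(1)] .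
  have Fc: "F \<subseteq> carrier L" using subringE(1)[OF sF] .
  have xc: "x \<in> carrier L" using x Fc by blast
  have Fsub: "subspace F"
    using Fc F(2) subringE(2,6,7)[OF sF] by (auto simp: subspace_def)
  have xF: "x [^] i \<in> F" for i :: nat
    using x(1) subringE(3,6)[OF sF] by (induction i) auto
  have invF: "inv (x \<ominus> a) \<in> F" if "a \<in> K" for a
  proof -
    have "x \<ominus> a \<in> F" using subspace_minus[OF Fsub x(1)] F(2) that by blast
    then show ?thesis using subfield_m_inv(1)[OF F(1)] minus_base_nonzero[OF xc x(2) that] by blast
  qed
  \<comment> \<open>As \<open>K\<close> contains zero and one, this gives the conditions on
    \<open>x\<close> required by \<open>pointwise_stabilizer_in_derived\<close>.\<close>
  have xK: "x \<notin> K"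
    using minus_base_nonzero[OF xc x(2), of x] xc by (auto simp: a_minus_def r_neg)
  \<comment> \<open>The choice makes \<open>S\<close> infinite and at least as large as
    \<open>K\<close>: powers of \<open>x\<close> suffice for finite \<open>K\<close>, and the
    elements \<open>inv (x \<ominus> a)\<close> are indexed by \<open>K\<close> itself.\<close>
  define S where "S = (if finite K then range (\<lambda>i::nat. x [^] i) else (\<lambda>a. inv (x \<ominus> a)) ` K)"
  have S: "lin_indep S" "S \<subseteq> F"
    using powers_lin_indep[OF xc x(2)] inverses_lin_indep[OF xc x(2)] xF invF by (auto simp: S_def)
  have Sinf: "infinite S"
    using range_inj_infinite[OF powers_inj[OF xc x(2)]]
      finite_image_iff[OF inverses_inj[OF xc x(2)]] by (auto simp: S_def)
  have KS: "|K| \<le>o |S|"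
  proof (cases "finite K")
    case True
    then show ?thesis using finite_ordLeq_infinite Sinf by blast
  next
    case False
    then show ?thesis
      using inverses_inj[OF xc x(2)] card_of_ordLeq[of K S] by (auto simp: S_def)
  qed
  obtain Y where Y: "S \<subseteq> Y" "lin_indep Y" "spn Y = F"
    using lin_indep_extends_to_basis[OF Fsub S] .
  have Yc: "Y \<subseteq> carrier L" using Y(2) by (simp add: lin_indep_def)
  obtain E where E: "Y \<subseteq> E" "lin_indep E" "spn E = carrier L"
    using lin_indep_extends_to_basis[OF subspace_carrier Y(2) Yc] .
  have Yinf: "infinite Y" using Sinf Y(1) finite_subset by blast
  have "|K| \<le>o |Y|" using ordLeq_transitive[OF KS card_of_mono1[OF Y(1)]] .
  then have LY: "|carrier L| \<le>o |Y|"
    using card_of_finite_transcendence_degree_bound[OF Yinf _ L] by blast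
  have "|UNIV :: int set| \<le>o |UNIV :: nat set|"
    using card_of_ordLeq[of "UNIV :: int set" "UNIV :: nat set"] inj_int_encode[of UNIV] by blast
  then have "|UNIV :: int set| \<le>o |Y|"
    using Yinf ordLeq_transitive unfolding infinite_iff_card_of_nat by blast
  then have "|carrier L \<times> (UNIV :: int set)| \<le>o |Y|"
    by (rule card_of_Times_infinite_bound[OF Yinf LY])
  then obtain g where g: "inj_on g (carrier L \<times> (UNIV :: int set))" "g ` (carrier L \<times> UNIV) \<subseteq> Y"
    unfolding card_of_ordLeq[symmetric] by blast
  \<comment> \<open>Level 0 must be the complement basis itself, which is disjoint from
    \<open>Y\<close>; the other levels are placed in \<open>Y\<close> by \<open>g\<close>. Together
    with injectivity of \<open>g\<close> this makes all levels disjoint.\<close>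
  define \<iota> where "\<iota> = (\<lambda>(z, k). if k = 0 then z else g (z, k))"
  have Ec: "E \<subseteq> carrier L" using E(2) by (simp add: lin_indep_def)
  have gY: "g (z, k) \<in> Y" if "z \<in> E" for z k using that g(2) Ec by blast
  interpret split_basis L K E Y "E - Y" \<iota>
  proof
    show "lin_indep E" "spn E = carrier L" using E by auto
    show "E = Y \<union> (E - Y)" "Y \<inter> (E - Y) = {}" using E(1) by auto
    show "\<iota> (z, 0) = z" for z by (simp add: \<iota>_def)
    show "\<iota> (z, k) \<in> Y" if "z \<in> E - Y" "k \<noteq> 0" for z k using that gY by (simp add: \<iota>_def)
    show "inj_on \<iota> ((E - Y) \<times> UNIV)"
    proof (rule inj_onI)
      fix u v assume uv: "u \<in> (E - Y) \<times> (UNIV :: int set)" "v \<in> (E - Y) \<times> (UNIV :: int set)" "\<iota> u = \<iota> v"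
      obtain z k z' k' where u: "u = (z, k)" and v: "v = (z', k')" by (metis surj_pair)
      have z: "z \<in> E" "z \<notin> Y" "z' \<in> E" "z' \<notin> Y" using uv u v by auto
      then have "(z, k) \<in> carrier L \<times> UNIV" "(z', k') \<in> carrier L \<times> UNIV" using Ec by auto
      then have "g (z, k) = g (z', k') \<Longrightarrow> (z, k) = (z', k')" using inj_onD[OF g(1)] by blast
      then show "u = v"
        using uv(3) z gY[OF z(1), of k] gY[OF z(3), of k'] unfolding u v \<iota>_def
        by (auto split: if_splits)
    qed
  qed
  show ?thesis
    by (rule pointwise_stabilizer_in_derived[OF Y(3) F(1) x(1) _ _ \<phi>]) (use xK in auto)
qed

text \<open>If the fixed field has a nonempty set of independent generators, any of them is the
  required transcendental element. Otherwise the fixed field is \<open>K\<close>, so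
  \<open>L\<close> is both algebraic and purely transcendental over \<open>K\<close>. Then
  \<open>L\<close> equals \<open>K\<close> and \<open>\<phi>\<close> is the identity.\<close>

lemma noether_solution_in_derived:
  assumes L: "purely_transcendental L K (carrier L)" "finite_transcendence_degree L K"
    and P: "noether_solution L K P" and \<phi>: "\<phi> \<in> P"
  shows "\<phi> \<in> derived (GL_ext L K) (carrier (GL_ext L K))"
proof -
  interpret GL: group "GL_ext L K" by (rule group_GL)
  let ?F = "fixed_field L P"
  obtain B where B: "algebraically_independent L K B" "?F = generate_field L (K \<union> B)"
    using P by (auto simp: noether_solution_def purely_transcendental_def)
  have "\<phi> \<in> carrier (Aut_ext L K)"
    using P \<phi> subgroup.mem_carrier by (auto simp: noether_solution_def)
  then have \<phi>GL: "\<phi> \<in> carrier (GL_ext L K)" by (rule Aut_in_GL)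
  have fixF: "\<phi> v = v" if "v \<in> ?F" for v using that \<phi> by (auto simp: fixed_field_def)
  show ?thesis
  proof (cases "B = {}")
    case False
    then obtain x where x: "x \<in> B" by blast
    have "K \<subseteq> ?F" "x \<in> ?F" unfolding B(2) using x by (auto intro: generate_field.incl)
    then show ?thesis
      using fixes_transcendental_in_derived[OF L(2) noether_solution_fixed_subfield[OF P] _ _
          algebraically_independent_transcendental[OF B(1) x] \<phi>GL fixF] by blast
  next
    case True
    have gK: "generate_field L K = K"
      using generate_fieldI[OF base_carrier subfield_base] by auto
    then have FK: "?F = K" using B(2) True by simp
    obtain B' where B': "algebraically_independent L K B'" "carrier L = generate_field L (K \<union> B')"
      using L(1) by (auto simp: purely_transcendental_def)
    have "B' = {}"
    proof (rule ccontr)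
      assume "B' \<noteq> {}"
      then obtain b where b: "b \<in> B'" by blast
      then have "b \<in> carrier L" using B'(1) by (auto simp: algebraically_independent_def)
      then have "algebraic K b" using P FK by (simp add: noether_solution_def algebraic_over_def)
      then show False using algebraically_independent_transcendental[OF B'(1) b] by simp
    qed
    then have "carrier L = K" using B'(2) gK by simp
    then have "\<phi> v = v" if "v \<in> carrier L" for v using fixF FK that by simp
    then have "\<phi> = \<one>\<^bsub>GL_ext L K\<^esub>"
      using GL_ext_eqI[OF \<phi>GL GL.one_closed] by (simp add: GL_ext_def BijGroup_def)
    then show ?thesis
      using subgroup.one_closed[OF GL.derived_is_subgroup[OF subset_refl]] by simp
  qed
qed

lemma height_group_in_derived:
  assumes L: "purely_transcendental L K (carrier L)" "finite_transcendence_degree L K"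
  shows "height_group L K G \<subseteq> derived (GL_ext L K) (carrier (GL_ext L K))"
proof
  interpret GL: group "GL_ext L K" by (rule group_GL)
  let ?D = "derived (GL_ext L K) (carrier (GL_ext L K))"
  have D: "subgroup ?D (GL_ext L K)" using GL.derived_is_subgroup[OF subset_refl] .
  have mem: "h \<in> ?D" "h \<in> carrier (Aut_ext L K)" if h: "h \<in> \<Union> (Psi_ext L K G)" for h
  proof -
    obtain P where P: "noether_solution L K P" "h \<in> P" using h by (auto simp: Psi_ext_def)
    then show "h \<in> ?D" "h \<in> carrier (Aut_ext L K)"
      using noether_solution_in_derived[OF L] subgroup.mem_carrier
      by (auto simp: noether_solution_def)
  qed
  \<comment> \<open>Both groups inherit their operations from \<open>BijGroup\<close>, so a product
    formed in \<open>Aut_ext L K\<close> can be followed inside the derived subgroup of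
    \<open>GL_ext L K\<close>.\<close>
  have ops: "\<one>\<^bsub>Aut_ext L K\<^esub> = \<one>\<^bsub>GL_ext L K\<^esub>" "monoid.mult (Aut_ext L K) = monoid.mult (GL_ext L K)"
    by (simp_all add: Aut_ext_def GL_ext_def)
  have inv: "inv\<^bsub>Aut_ext L K\<^esub> h = inv\<^bsub>GL_ext L K\<^esub> h" if "h \<in> carrier (Aut_ext L K)" for h
    using group.m_inv_consistent[OF group_BijGroup subgroup_Aut that]
      group.m_inv_consistent[OF group_BijGroup subgroup_GL Aut_in_GL[OF that]]
    by (simp add: Aut_ext_def GL_ext_def)
  fix h assume "h \<in> height_group L K G"
  then have "h \<in> generate (Aut_ext L K) (\<Union> (Psi_ext L K G))" by (simp add: height_group_def)
  then show "h \<in> ?D"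
    by induction (use subgroup.one_closed[OF D] subgroup.m_closed[OF D] subgroup.m_inv_closed[OF D]
        mem inv ops in auto)
qed

text \<open>The derived group becomes trivial in the abelianization, so the class height group has
  one element and the trivial subgroup of \<open>M\<close> serves as \<open>S\<close>.\<close>

lemma class_height_group_embeds:
  assumes L: "purely_transcendental L K (carrier L)" "finite_transcendence_degree L K"
    and G: "noether_solution L K G"
  defines "M \<equiv> Multiplicative_Group.mult_of (L\<lparr>carrier := fixed_field L G\<rparr>)"
  shows "\<exists>S. subgroup S M \<and> class_height_group L K G \<cong> M\<lparr>carrier := S\<rparr>"
proof (intro exI conjI)
  interpret GL: group "GL_ext L K" by (rule group_GL)
  interpret M: group M
    unfolding M_def
    using field.field_mult_group[of "L\<lparr>carrier := fixed_field L G\<rparr>"] subfield_iff(2)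
      noether_solution_fixed_subfield[OF G] by blast
  show "subgroup {\<one>\<^bsub>M\<^esub>} M" by (rule M.triv_subgroup)
  let ?D = "derived (GL_ext L K) (carrier (GL_ext L K))"
  have D: "subgroup ?D (GL_ext L K)" using GL.derived_is_subgroup[OF subset_refl] .
  have "\<one>\<^bsub>Aut_ext L K\<^esub> \<in> height_group L K G" unfolding height_group_def by (rule generate.one)
  moreover have "abelianization_map (GL_ext L K) h = ?D" if "h \<in> height_group L K G" for h
    using height_group_in_derived[OF L] that subgroup.rcos_const[OF D group_GL]
    by (auto simp: abelianization_map_def)
  ultimately have "carrier (class_height_group L K G) = {?D}"
    unfolding class_height_group_def by (simp, blast)
  then have "(\<lambda>_. \<one>\<^bsub>M\<^esub>) \<in> iso (class_height_group L K G) (M\<lparr>carrier := {\<one>\<^bsub>M\<^esub>}\<rparr>)"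
    using M.l_one[OF M.one_closed] by (auto simp: iso_def hom_def bij_betw_def)
  then show "class_height_group L K G \<cong> M\<lparr>carrier := {\<one>\<^bsub>M\<^esub>}\<rparr>"
    by (auto simp: is_iso_def)
qed

end

theorem theorem1p6:
  fixes L :: "('a, 'b) ring_scheme" and K :: "'a set"
  assumes "field L"
    and "subfield K L"
    and "purely_transcendental L K (carrier L)"
    and "finite_transcendence_degree L K"
  shows
    "(\<forall>G. subgroup G (Aut_ext L K) \<longrightarrow>
        (noether_solution L K G \<longleftrightarrow>
          (\<forall>\<phi> \<in> carrier (Aut_ext L K). noether_solution L K (conjugate_by (Aut_ext L K) \<phi> G))) \<and>
        (noether_solution L K G \<longrightarrow>
          Con_ext L K G = {conjugate_by (Aut_ext L K) \<phi> G | \<phi>. \<phi> \<in> carrier (Aut_ext L K)})) \<and>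
     (\<forall>G. noether_solution L K G \<longrightarrow>
        con_ext L K G \<le>o ind_ext L K G \<and>
        (\<forall>m :: nat. ind_ext L K G =o |{..<m}| \<longrightarrow>
          finite (Con_ext L K G) \<and> card (Con_ext L K G) \<le> m)) \<and>
     (\<forall>G. noether_solution L K G \<longrightarrow>
        (\<exists>!\<Phi>. zorn_component (Psi_ext L K G) \<Phi>) \<longrightarrow>
        (\<exists>S. subgroup S (Multiplicative_Group.mult_of (L\<lparr>carrier := fixed_field L G\<rparr>)) \<and>
             class_height_group L K G \<cong> (Multiplicative_Group.mult_of (L\<lparr>carrier := fixed_field L G\<rparr>))\<lparr>carrier := S\<rparr>))"
proof -
  interpret field_ext L K
    using assms(1,2) by (simp add: field_ext_def field_ext_axioms_def)
  interpret A: group "Aut_ext L K" by (rule group_Aut)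
  \<comment> \<open>For the converse direction the conjugating automorphism is taken to be the
    identity.\<close>
  have "noether_solution L K G \<longleftrightarrow>
      (\<forall>\<phi> \<in> carrier (Aut_ext L K). noether_solution L K (conjugate_by (Aut_ext L K) \<phi> G))"
    if "subgroup G (Aut_ext L K)" for G
    using noether_solution_conjugate_by A.conjugate_by_one[OF subgroup.subset[OF that]]
    by (metis A.one_closed)
  moreover have "finite (Con_ext L K G) \<and> card (Con_ext L K G) \<le> m"
    if "noether_solution L K G" "ind_ext L K G =o |{..<m}|" for G and m :: nat
  proof -
    have "|Con_ext L K G| \<le>o |{..<m}|"
      using ordLeq_ordIso_trans[OF con_ext_le_ind_ext[OF that(1)] that(2)] by (simp add: con_ext_def)
    \<comment> \<open>The cardinal inequality is turned into an injection into an initial segment of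
      the natural numbers, which yields both finiteness and the numerical bound.\<close>
    then obtain f where "inj_on f (Con_ext L K G)" "f ` Con_ext L K G \<subseteq> {..<m}"
      unfolding card_of_ordLeq[symmetric] by blast
    then show ?thesis
      using inj_on_finite[of f _ "{..<m}"] card_inj_on_le[of f _ "{..<m}"] by auto
  qed
  ultimately show ?thesis
    using Con_ext_eq con_ext_le_ind_ext class_height_group_embeds[OF assms(3,4)] by simp
qed

end
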